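(* Let $T=((\Omega,\mathcal{A}),\{(\Omega,\mathcal{M}_i)\}_{i\in N},\{t_i\}_{i\in N})$ be a type space. Then exactly one of the following holds: (a) the players' beliefs in $T$ are universally consistent; (b) there exists a weakly agreeable bet in $T$.
   Context: A field on a set $X$ is a collection of subsets of $X$ containing $X$ and closed under complements and finite intersections. For a field $\mathcal{A}$ on $\Omega$, $\mathrm{pba}(\Omega,\mathcal{A})$ is the set of finitely additive nonnegative $P:\mathcal{A}\to\mathbb{R}$ with $P(\Omega)=1$; $B(\Omega,\mathcal{A})$ is the sup-norm closure of the linear span of indicators of sets in $\mathcal{A}$ (integrable against bounded finitely additive set functions). $\mathrm{ba}(\Omega,\mathcal{A})$ (bounded finitely additive set functions on $\mathcal{A}$) carries the weak* topology, the weakest making $\mu\mapsto\int f\,d\mu$ continuous for all $f\in B(\Omega,\mathcal{A})$; $\overline{\,\cdot\,}^\ast$ denotes weak* closure. A type space is $T=((\Omega,\mathcal{A}),\{(\Omega,\mathcal{M}_i)\}_{i\in N},\{t_i\}_{i\in N})$ with $N$ a nonempty set of players, $\mathcal{A}$ and $\mathcal{M}_i\subseteq\mathcal{A}$ fields on the set $\Omega$, and $t_i:\Omega\times\mathcal{A}\to[0,1]$ with: $t_i(\omega,\cdot)\in\mathrm{pba}(\Omega,\mathcal{A})$; $t_i(\cdot,E)\in B(\Omega,\mathcal{M}_i)$ for all $E\in\mathcal{A}$; $t_i(\omega,E)=1$ whenever $E\in\mathcal{M}_i$, $\omega\in E$. Let $\Pi_i=\overline{\mathrm{conv}\{t_i(\omega,\cdot):\omega\in\Omega\}}^\ast$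 (equivalently the $P\in\mathrm{pba}(\Omega,\mathcal{A})$ with $P(E\cap F)=\int_F t_i(\cdot,E)\,dP$ for all $E\in\mathcal{A},F\in\mathcal{M}_i$). For $I\subseteq N$, a nonempty $S\subseteq\Omega$ is an $I$-common certainty component if there is $E\in\mathcal{A}$ with $E\subseteq S$ and $t_i(\omega,E)=1$ for all $\omega\in S$, $i\in I$. A set $E\subseteq\Omega$ is $I$-commonly certain at $\omega$ if there is an $I$-common certainty component $S$ with $\omega\in S\subseteq E$. The players' beliefs are universally consistent if for every finite $I\subseteq N$ and every $I$-common certainty component $S$ there is $P\in\bigcap_{i\in I}\Pi_i$ with $\inf\{P(E):E\in\mathcal{A},\ S\subseteq E\}>0$. A bet is a family $(f_i)_{i\in I}$, $I\subseteq N$ finite, $f_i\in B(\Omega,\mathcal{A})$, with $\sum_{i\in I}f_i(\omega)=0$ for all $\omega$. A bet is weakly agreeable if for every $\omega\in\Omega$ the set $\{\omega':\int f_i\,dt_i(\omega',\cdot)\ge0\ \forall i\in I\}$ is $I$-commonly certain at $\omega$, and there exist $\omega\in\Omega$ and $\alpha>0$ such that $\{\omega':\int f_i\,dt_i(\omega',\cdot)\ge\alpha\ \forall i\in I\}$ is $I$-commonly certain at $\omega$.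
   Formalization: A bet is required to involve a nonempty finite set I of players; with I empty, the empty bet would be vacuously weakly agreeable whenever Ω is nonempty, so (a) and (b) could both hold. *)

theory Defs
  imports "HOL-Analysis.Analysis"
begin

(* A field on a set \<Omega> is the library notion  algebra \<Omega> A  (Sigma_Algebra.thy):
   A \<subseteq> Pow \<Omega>, {} \<in> A, closed under complement in \<Omega> and finite intersections
   (see algebra_iff_Int). Set functions are modelled as 'w set \<Rightarrow> real; only their
   values on A matter. Functions on \<Omega> are 'w \<Rightarrow> real; only values on \<Omega> matter. *)

definition fin_add :: "'w set set \<Rightarrow> ('w set \<Rightarrow> real) \<Rightarrow> bool" where
  "fin_add A \<mu> \<longleftrightarrow> (\<forall>E\<in>A. \<forall>F\<in>A. E \<inter> F = {} \<longrightarrow> \<mu> (E \<union> F) = \<mu> E + \<mu> F)"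

definition ba :: "'w set \<Rightarrow> 'w set set \<Rightarrow> ('w set \<Rightarrow> real) \<Rightarrow> bool" where
  "ba \<Omega> A \<mu> \<longleftrightarrow> fin_add A \<mu> \<and> (\<exists>c. \<forall>E\<in>A. \<bar>\<mu> E\<bar> \<le> c)"

definition pba :: "'w set \<Rightarrow> 'w set set \<Rightarrow> ('w set \<Rightarrow> real) \<Rightarrow> bool" where
  "pba \<Omega> A P \<longleftrightarrow> fin_add A P \<and> (\<forall>E\<in>A. 0 \<le> P E) \<and> P \<Omega> = 1"

text \<open>Elements of the linear span of indicators of sets in the field A (restricted to \<Omega>):
  exactly the functions with finitely many values on \<Omega> whose level sets lie in A.\<close>
definition simple_fun :: "'w set \<Rightarrow> 'w set set \<Rightarrow> ('w \<Rightarrow> real) \<Rightarrow> bool" where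
  "simple_fun \<Omega> A s \<longleftrightarrow> finite (s ` \<Omega>) \<and> (\<forall>v\<in>s ` \<Omega>. {\<omega>\<in>\<Omega>. s \<omega> = v} \<in> A)"

definition simple_integral :: "'w set \<Rightarrow> ('w set \<Rightarrow> real) \<Rightarrow> ('w \<Rightarrow> real) \<Rightarrow> real" where
  "simple_integral \<Omega> \<mu> s = (\<Sum>v\<in>s ` \<Omega>. v * \<mu> {\<omega>\<in>\<Omega>. s \<omega> = v})"

definition B_space :: "'w set \<Rightarrow> 'w set set \<Rightarrow> ('w \<Rightarrow> real) set" where
  "B_space \<Omega> A = {f. \<forall>\<epsilon>>0. \<exists>s. simple_fun \<Omega> A s \<and> (\<forall>\<omega>\<in>\<Omega>. \<bar>f \<omega> - s \<omega>\<bar> \<le> \<epsilon>)}"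

definition approx_simple :: "'w set \<Rightarrow> 'w set set \<Rightarrow> ('w \<Rightarrow> real) \<Rightarrow> nat \<Rightarrow> ('w \<Rightarrow> real)" where
  "approx_simple \<Omega> A f n =
     (SOME s. simple_fun \<Omega> A s \<and> (\<forall>\<omega>\<in>\<Omega>. \<bar>f \<omega> - s \<omega>\<bar> \<le> 1 / (real n + 1)))"

definition fa_integral :: "'w set \<Rightarrow> 'w set set \<Rightarrow> ('w set \<Rightarrow> real) \<Rightarrow> ('w \<Rightarrow> real) \<Rightarrow> real" where
  "fa_integral \<Omega> A \<mu> f = lim (\<lambda>n. simple_integral \<Omega> \<mu> (approx_simple \<Omega> A f n))"

definition weak_star_closure :: "'w set \<Rightarrow> 'w set set \<Rightarrow> ('w set \<Rightarrow> real) set \<Rightarrow> ('w set \<Rightarrow> real) set" where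
  "weak_star_closure \<Omega> A K =
     {\<mu>. ba \<Omega> A \<mu> \<and>
          (\<forall>Fs. finite Fs \<and> Fs \<subseteq> B_space \<Omega> A \<longrightarrow> (\<forall>\<epsilon>>0. \<exists>\<nu>\<in>K.
              \<forall>f\<in>Fs. \<bar>fa_integral \<Omega> A \<mu> f - fa_integral \<Omega> A \<nu> f\<bar> < \<epsilon>))}"

definition type_space ::
  "'w set \<Rightarrow> 'w set set \<Rightarrow> 'i set \<Rightarrow> ('i \<Rightarrow> 'w set set) \<Rightarrow> ('i \<Rightarrow> 'w \<Rightarrow> 'w set \<Rightarrow> real) \<Rightarrow> bool" where
  "type_space \<Omega> A N M t \<longleftrightarrow>
     N \<noteq> {} \<and> algebra \<Omega> A \<and>
     (\<forall>i\<in>N. algebra \<Omega> (M i) \<and> M i \<subseteq> A \<and>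
        (\<forall>\<omega>\<in>\<Omega>. \<forall>E\<in>A. 0 \<le> t i \<omega> E \<and> t i \<omega> E \<le> 1) \<and>
        (\<forall>\<omega>\<in>\<Omega>. pba \<Omega> A (t i \<omega>)) \<and>
        (\<forall>E\<in>A. (\<lambda>\<omega>. t i \<omega> E) \<in> B_space \<Omega> (M i)) \<and>
        (\<forall>E\<in>M i. \<forall>\<omega>\<in>E. t i \<omega> E = 1))"

definition conv_types :: "'w set \<Rightarrow> ('i \<Rightarrow> 'w \<Rightarrow> 'w set \<Rightarrow> real) \<Rightarrow> 'i \<Rightarrow> ('w set \<Rightarrow> real) set" where
  "conv_types \<Omega> t i =
     {P. \<exists>(n::nat) (w::nat \<Rightarrow> 'w) (l::nat \<Rightarrow> real).
           (\<forall>k<n. w k \<in> \<Omega> \<and> 0 \<le> l k) \<and> (\<Sum>k<n. l k) = 1 \<and>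
           P = (\<lambda>E. \<Sum>k<n. l k * t i (w k) E)}"

definition Pi_i :: "'w set \<Rightarrow> 'w set set \<Rightarrow> ('i \<Rightarrow> 'w \<Rightarrow> 'w set \<Rightarrow> real) \<Rightarrow> 'i \<Rightarrow> ('w set \<Rightarrow> real) set" where
  "Pi_i \<Omega> A t i = weak_star_closure \<Omega> A (conv_types \<Omega> t i)"

definition cc_component ::
  "'w set \<Rightarrow> 'w set set \<Rightarrow> ('i \<Rightarrow> 'w \<Rightarrow> 'w set \<Rightarrow> real) \<Rightarrow> 'i set \<Rightarrow> 'w set \<Rightarrow> bool" where
  "cc_component \<Omega> A t I S \<longleftrightarrow>
     S \<noteq> {} \<and> S \<subseteq> \<Omega> \<and> (\<exists>E\<in>A. E \<subseteq> S \<and> (\<forall>\<omega>\<in>S. \<forall>i\<in>I. t i \<omega> E = 1))"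

definition commonly_certain ::
  "'w set \<Rightarrow> 'w set set \<Rightarrow> ('i \<Rightarrow> 'w \<Rightarrow> 'w set \<Rightarrow> real) \<Rightarrow> 'i set \<Rightarrow> 'w set \<Rightarrow> 'w \<Rightarrow> bool" where
  "commonly_certain \<Omega> A t I E \<omega> \<longleftrightarrow> (\<exists>S. cc_component \<Omega> A t I S \<and> \<omega> \<in> S \<and> S \<subseteq> E)"

definition universally_consistent ::
  "'w set \<Rightarrow> 'w set set \<Rightarrow> 'i set \<Rightarrow> ('i \<Rightarrow> 'w \<Rightarrow> 'w set \<Rightarrow> real) \<Rightarrow> bool" where
  "universally_consistent \<Omega> A N t \<longleftrightarrow>
     (\<forall>I S. finite I \<and> I \<subseteq> N \<and> cc_component \<Omega> A t I S \<longrightarrow>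
        (\<exists>P. pba \<Omega> A P \<and> (\<forall>i\<in>I. P \<in> Pi_i \<Omega> A t i) \<and>
             Inf {P E | E. E \<in> A \<and> S \<subseteq> E} > 0))"

definition is_bet :: "'w set \<Rightarrow> 'w set set \<Rightarrow> 'i set \<Rightarrow> 'i set \<Rightarrow> ('i \<Rightarrow> 'w \<Rightarrow> real) \<Rightarrow> bool" where
  "is_bet \<Omega> A N I f \<longleftrightarrow>
     finite I \<and> I \<noteq> {} \<and> I \<subseteq> N \<and> (\<forall>i\<in>I. f i \<in> B_space \<Omega> A) \<and>
     (\<forall>\<omega>\<in>\<Omega>. (\<Sum>i\<in>I. f i \<omega>) = 0)"

definition weakly_agreeable ::
  "'w set \<Rightarrow> 'w set set \<Rightarrow> 'i set \<Rightarrow> ('i \<Rightarrow> 'w \<Rightarrow> 'w set \<Rightarrow> real) \<Rightarrow> 'i set \<Rightarrow> ('i \<Rightarrow> 'w \<Rightarrow> real) \<Rightarrow> bool" where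
  "weakly_agreeable \<Omega> A N t I f \<longleftrightarrow>
     is_bet \<Omega> A N I f \<and>
     (\<forall>\<omega>\<in>\<Omega>. commonly_certain \<Omega> A t I
         {\<omega>'\<in>\<Omega>. \<forall>i\<in>I. fa_integral \<Omega> A (t i \<omega>') (f i) \<ge> 0} \<omega>) \<and>
     (\<exists>\<omega>\<in>\<Omega>. \<exists>\<alpha>>0. commonly_certain \<Omega> A t I
         {\<omega>'\<in>\<Omega>. \<forall>i\<in>I. fa_integral \<Omega> A (t i \<omega>') (f i) \<ge> \<alpha>} \<omega>)"

end

theory Submission
  imports Defs
begin

text \<open>
  If \<open>P\<close> lies in every \<open>\<Pi>\<^sub>i\<close>, then \<open>P\<close> integrates \<open>f\<^sub>i\<close> and its posterior expectation
  \<open>g\<^sub>i = \<integral> f\<^sub>i dt\<^sub>i\<close> equally. For a weakly agreeable bet the \<open>g\<^sub>i\<close> are nonnegative and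
  bounded away from \<open>0\<close> on a component of positive outer measure, contradicting
  \<open>\<Sum>\<^sub>i f\<^sub>i = 0\<close>.

  Conversely, let \<open>S\<close> be an \<open>I\<close>-common certainty component with core \<open>E \<in> A\<close>, and let \<open>K\<^sub>i\<close> be the
  cone of functions with nonnegative posterior expectation for player \<open>i\<close>. Consider the cone of
  functions that dominate some \<open>\<Sum>\<^sub>i h\<^sub>i\<close>, \<open>h\<^sub>i \<in> K\<^sub>i\<close>, on \<open>E\<close>. If it omits \<open>-1\<close>, Zorn's lemma
  extends it to a total cone, that is, to a mean which is nonnegative on every \<open>K\<^sub>i\<close> and carried
  by \<open>E\<close>; by separation in finitely many coordinates it lies in every \<open>\<Pi>\<^sub>i\<close>. If it contains
  \<open>-1\<close>, then \<open>f\<^sub>i = (h\<^sub>i - \<Sum>\<^sub>j h\<^sub>j / |I|) 1\<^sub>E\<close> is a weakly agreeable bet: since \<open>E\<close> is certain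
  at each of its points, every type gives \<open>E\<close> probability \<open>0\<close> or \<open>1\<close>, so cutting off outside \<open>E\<close>
  costs nobody anything.
\<close>

section \<open>Simple functions and uniform limits\<close>

text \<open>The codomain is arbitrary so that two simple functions can be paired into one finitely
  valued map, whose level sets form the common refinement of theirs.\<close>

definition fin_meas :: "'w set \<Rightarrow> 'w set set \<Rightarrow> ('w \<Rightarrow> 'b) \<Rightarrow> bool" where
  "fin_meas \<Omega> A q \<longleftrightarrow> finite (q ` \<Omega>) \<and> (\<forall>b\<in>q ` \<Omega>. {\<omega>\<in>\<Omega>. q \<omega> = b} \<in> A)"

lemma simple_fun_iff_fin_meas: "simple_fun \<Omega> A s \<longleftrightarrow> fin_meas \<Omega> A s"
  by (simp add: simple_fun_def fin_meas_def)

lemma B_space_mono: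
  assumes "M \<subseteq> A"
  shows "B_space \<Omega> M \<subseteq> B_space \<Omega> A"
proof -
  have "simple_fun \<Omega> A s" if "simple_fun \<Omega> M s" for s
    using that assms by (auto simp: simple_fun_def)
  then show ?thesis
    unfolding B_space_def by (intro Collect_mono) metis
qed

lemma B_spaceE:
  assumes "f \<in> B_space \<Omega> A" "0 < e"
  obtains s where "simple_fun \<Omega> A s" "\<And>\<omega>. \<omega> \<in> \<Omega> \<Longrightarrow> \<bar>f \<omega> - s \<omega>\<bar> \<le> e"
  using assms unfolding B_space_def by blast

lemma B_space_bounded:
  assumes "f \<in> B_space \<Omega> A"
  obtains b where "0 \<le> b" "\<And>\<omega>. \<omega> \<in> \<Omega> \<Longrightarrow> \<bar>f \<omega>\<bar> \<le> b"
proof -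
  obtain s where s: "simple_fun \<Omega> A s" "\<And>\<omega>. \<omega> \<in> \<Omega> \<Longrightarrow> \<bar>f \<omega> - s \<omega>\<bar> \<le> 1"
    using B_spaceE[OF assms, of 1] by auto
  have fin: "finite (s ` \<Omega>)"
    using s(1) by (simp add: simple_fun_def)
  define b where "b = (\<Sum>v\<in>s ` \<Omega>. \<bar>v\<bar>) + 1"
  have "\<bar>s \<omega>\<bar> \<le> (\<Sum>v\<in>s ` \<Omega>. \<bar>v\<bar>)" if "\<omega> \<in> \<Omega>" for \<omega>
    by (rule member_le_sum) (use that fin in auto)
  then have "\<bar>f \<omega>\<bar> \<le> b" if "\<omega> \<in> \<Omega>" for \<omega>
    using s(2)[OF that] that unfolding b_def by fastforce
  moreover have "0 \<le> b"
    unfolding b_def by (simp add: sum_nonneg)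
  ultimately show ?thesis
    using that by blast
qed

context algebra
begin

section \<open>Finitely valued maps with level sets in a field\<close>

lemma fin_meas_preimage:
  assumes "fin_meas \<Omega> M q"
  shows "{\<omega>\<in>\<Omega>. Q (q \<omega>)} \<in> M"
proof -
  have "{\<omega>\<in>\<Omega>. Q (q \<omega>)} = (\<Union>b\<in>{b \<in> q ` \<Omega>. Q b}. {\<omega>\<in>\<Omega>. q \<omega> = b})"
    by auto
  also have "\<dots> \<in> M"
    using assms unfolding fin_meas_def by (intro finite_UN) auto
  finally show ?thesis .
qed

lemma fin_meas_comp:
  assumes "fin_meas \<Omega> M q"
  shows "fin_meas \<Omega> M (\<lambda>\<omega>. \<phi> (q \<omega>))"
proof -
  have "(\<lambda>\<omega>. \<phi> (q \<omega>)) ` \<Omega> = \<phi> ` q ` \<Omega>"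
    by (simp only: image_image)
  moreover have "finite (\<phi> ` q ` \<Omega>)"
    using assms by (simp add: fin_meas_def)
  ultimately show ?thesis
    using fin_meas_preimage[OF assms, of "\<lambda>x. \<phi> x = b" for b] by (simp add: fin_meas_def)
qed

lemma fin_meas_pair:
  assumes "fin_meas \<Omega> M q" "fin_meas \<Omega> M r"
  shows "fin_meas \<Omega> M (\<lambda>\<omega>. (q \<omega>, r \<omega>))"
proof -
  have "finite ((\<lambda>\<omega>. (q \<omega>, r \<omega>)) ` \<Omega>)"
    by (rule finite_subset[of _ "q ` \<Omega> \<times> r ` \<Omega>"]) (use assms in \<open>auto simp: fin_meas_def\<close>)
  moreover have "{\<omega>\<in>\<Omega>. (q \<omega>, r \<omega>) = b} \<in> M" for b
  proof -
    have "{\<omega>\<in>\<Omega>. (q \<omega>, r \<omega>) = b} = {\<omega>\<in>\<Omega>. q \<omega> = fst b} \<inter> {\<omega>\<in>\<Omega>. r \<omega> = snd b}"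
      by auto
    then show ?thesis
      using fin_meas_preimage[OF assms(1), of "\<lambda>x. x = fst b"]
        fin_meas_preimage[OF assms(2), of "\<lambda>x. x = snd b"] by (simp only: Int)
  qed
  ultimately show ?thesis
    by (auto simp: fin_meas_def)
qed

lemma fin_meas_indicator: "E \<in> M \<Longrightarrow> fin_meas \<Omega> M (indicator E :: 'a \<Rightarrow> real)"
proof -
  assume E: "E \<in> M"
  have "finite (indicator E ` \<Omega> :: real set)"
    by (rule finite_subset[of _ "{0, 1}"]) (auto simp: indicator_def)
  moreover have "{\<omega>\<in>\<Omega>. indicator E \<omega> = (1::real)} = E" "{\<omega>\<in>\<Omega>. indicator E \<omega> = (0::real)} = \<Omega> - E"
    using E sets_into_space by (auto simp: indicator_def)
  ultimately show ?thesis
    using E by (auto simp: fin_meas_def indicator_def)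
qed

lemma fin_meas_const: "fin_meas \<Omega> M (\<lambda>_. c)"
  by (auto simp: fin_meas_def image_constant_conv)

section \<open>Closure properties of the space B\<close>

lemma B_spaceI_simple:
  assumes "simple_fun \<Omega> M s"
  shows "s \<in> B_space \<Omega> M"
  unfolding B_space_def
proof (intro CollectI allI impI)
  show "\<exists>r. simple_fun \<Omega> M r \<and> (\<forall>\<omega>\<in>\<Omega>. \<bar>s \<omega> - r \<omega>\<bar> \<le> e)" if "0 < e" for e
    using assms that by (intro exI[of _ s]) simp
qed

lemma B_space_const: "(\<lambda>_. c) \<in> B_space \<Omega> M"
  by (simp add: B_spaceI_simple simple_fun_iff_fin_meas fin_meas_const)

lemma B_space_indicator: "E \<in> M \<Longrightarrow> indicator E \<in> B_space \<Omega> M"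
  by (simp add: B_spaceI_simple simple_fun_iff_fin_meas fin_meas_indicator)

text \<open>Applying \<open>\<phi>\<close> to simple approximants of \<open>f\<close> and
  \<open>g\<close> gives a simple function by pairing, and the Lipschitz bound controls the error.
  Sums, differences and scalar multiples are instances.\<close>

lemma B_space_lipschitz2:
  assumes f: "f \<in> B_space \<Omega> M" and g: "g \<in> B_space \<Omega> M" and "0 \<le> K"
    and lip: "\<And>\<omega> x y. \<omega> \<in> \<Omega> \<Longrightarrow> \<bar>\<phi> (f \<omega>) (g \<omega>) - \<phi> x y\<bar> \<le> K * (\<bar>f \<omega> - x\<bar> + \<bar>g \<omega> - y\<bar>)"
  shows "(\<lambda>\<omega>. \<phi> (f \<omega>) (g \<omega>)) \<in> B_space \<Omega> M"
  unfolding B_space_def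
proof (intro CollectI allI impI)
  fix e :: real assume e: "0 < e"
  \<comment> \<open>Two errors of size \<open>d\<close> cost at most \<open>2 * K * d\<close>; the
    \<open>+ 1\<close> keeps the denominator positive when \<open>K = 0\<close>.\<close>
  define d where "d = e / (2 * K + 1)"
  have d: "0 < d" "K * (2 * d) \<le> e"
    using e \<open>0 \<le> K\<close> by (auto simp: d_def field_simps)
  obtain s where s: "simple_fun \<Omega> M s" "\<And>\<omega>. \<omega> \<in> \<Omega> \<Longrightarrow> \<bar>f \<omega> - s \<omega>\<bar> \<le> d"
    using B_spaceE[OF f d(1)] by blast
  obtain r where r: "simple_fun \<Omega> M r" "\<And>\<omega>. \<omega> \<in> \<Omega> \<Longrightarrow> \<bar>g \<omega> - r \<omega>\<bar> \<le> d"
    using B_spaceE[OF g d(1)] by blast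
  have "simple_fun \<Omega> M (\<lambda>\<omega>. \<phi> (s \<omega>) (r \<omega>))"
    using fin_meas_comp[OF fin_meas_pair, of s r "\<lambda>p. \<phi> (fst p) (snd p)"] s(1) r(1)
    by (simp add: simple_fun_iff_fin_meas)
  moreover have "\<bar>\<phi> (f \<omega>) (g \<omega>) - \<phi> (s \<omega>) (r \<omega>)\<bar> \<le> e" if "\<omega> \<in> \<Omega>" for \<omega>
  proof -
    have "\<bar>\<phi> (f \<omega>) (g \<omega>) - \<phi> (s \<omega>) (r \<omega>)\<bar> \<le> K * (\<bar>f \<omega> - s \<omega>\<bar> + \<bar>g \<omega> - r \<omega>\<bar>)"
      by (rule lip[OF that])
    also have "\<dots> \<le> K * (2 * d)"
      using s(2)[OF that] r(2)[OF that] \<open>0 \<le> K\<close> by (intro mult_left_mono) auto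
    finally show ?thesis
      using d(2) by simp
  qed
  ultimately show "\<exists>s. simple_fun \<Omega> M s \<and> (\<forall>\<omega>\<in>\<Omega>. \<bar>\<phi> (f \<omega>) (g \<omega>) - s \<omega>\<bar> \<le> e)"
    by blast
qed

lemma B_space_add:
  assumes "f \<in> B_space \<Omega> M" "g \<in> B_space \<Omega> M"
  shows "(\<lambda>\<omega>. f \<omega> + g \<omega>) \<in> B_space \<Omega> M"
proof (rule B_space_lipschitz2[OF assms, of 1])
  show "\<bar>f \<omega> + g \<omega> - (x + y)\<bar> \<le> 1 * (\<bar>f \<omega> - x\<bar> + \<bar>g \<omega> - y\<bar>)" for \<omega> x y
    using abs_triangle_ineq[of "f \<omega> - x" "g \<omega> - y"] by (simp add: algebra_simps)
qed simp

lemma B_space_diff: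
  assumes "f \<in> B_space \<Omega> M" "g \<in> B_space \<Omega> M"
  shows "(\<lambda>\<omega>. f \<omega> - g \<omega>) \<in> B_space \<Omega> M"
proof (rule B_space_lipschitz2[OF assms, of 1])
  show "\<bar>f \<omega> - g \<omega> - (x - y)\<bar> \<le> 1 * (\<bar>f \<omega> - x\<bar> + \<bar>g \<omega> - y\<bar>)" for \<omega> x y
    using abs_triangle_ineq4[of "f \<omega> - x" "g \<omega> - y"] by (simp add: algebra_simps)
qed simp

lemma B_space_cmult:
  assumes "f \<in> B_space \<Omega> M"
  shows "(\<lambda>\<omega>. c * f \<omega>) \<in> B_space \<Omega> M"
proof (rule B_space_lipschitz2[OF assms assms, of "\<bar>c\<bar>" "\<lambda>x y. c * x"])
  show "\<bar>c * f \<omega> - c * x\<bar> \<le> \<bar>c\<bar> * (\<bar>f \<omega> - x\<bar> + \<bar>f \<omega> - y\<bar>)" for \<omega> x y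
    unfolding right_diff_distrib[symmetric] abs_mult by (rule mult_left_mono) auto
qed simp

lemma B_space_sum:
  "(\<And>i. i \<in> I \<Longrightarrow> f i \<in> B_space \<Omega> M) \<Longrightarrow> (\<lambda>\<omega>. \<Sum>i\<in>I. f i \<omega>) \<in> B_space \<Omega> M"
proof (induction I rule: infinite_finite_induct)
  case (insert i I)
  then show ?case
    using B_space_add[of "f i" "\<lambda>\<omega>. \<Sum>i\<in>I. f i \<omega>"] by simp
qed (simp_all add: B_space_const)

text \<open>Multiplication is not globally Lipschitz, so the scheme above does not cover it. The
  indicator is kept exact and only \<open>f\<close> is approximated, so the error does not
  grow.\<close>

lemma B_space_mult_indicator:
  assumes "f \<in> B_space \<Omega> M" "E \<in> M"
  shows "(\<lambda>\<omega>. f \<omega> * indicator E \<omega>) \<in> B_space \<Omega> M"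
  unfolding B_space_def
proof (intro CollectI allI impI)
  fix e :: real assume e: "0 < e"
  obtain s where s: "simple_fun \<Omega> M s" "\<And>\<omega>. \<omega> \<in> \<Omega> \<Longrightarrow> \<bar>f \<omega> - s \<omega>\<bar> \<le> e"
    using B_spaceE[OF assms(1) e] by blast
  have "simple_fun \<Omega> M (\<lambda>\<omega>. s \<omega> * indicator E \<omega>)"
    using fin_meas_comp[OF fin_meas_pair[OF _ fin_meas_indicator[OF assms(2)]], of s "\<lambda>p. fst p * snd p"] s(1)
    by (simp add: simple_fun_iff_fin_meas)
  moreover have "\<bar>f \<omega> * indicator E \<omega> - s \<omega> * indicator E \<omega>\<bar> \<le> e" if "\<omega> \<in> \<Omega>" for \<omega>
    using s(2)[OF that] e by (auto simp: indicator_def)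
  ultimately show "\<exists>s. simple_fun \<Omega> M s \<and> (\<forall>\<omega>\<in>\<Omega>. \<bar>f \<omega> * indicator E \<omega> - s \<omega>\<bar> \<le> e)"
    by blast
qed

lemma B_space_uniform_limit:
  assumes "\<And>e. 0 < e \<Longrightarrow> \<exists>g\<in>B_space \<Omega> M. \<forall>\<omega>\<in>\<Omega>. \<bar>f \<omega> - g \<omega>\<bar> \<le> e"
  shows "f \<in> B_space \<Omega> M"
  unfolding B_space_def
proof (intro CollectI allI impI)
  fix e :: real assume "0 < e"
  then have e: "0 < e / 2" by simp
  obtain g where g: "g \<in> B_space \<Omega> M" "\<And>\<omega>. \<omega> \<in> \<Omega> \<Longrightarrow> \<bar>f \<omega> - g \<omega>\<bar> \<le> e / 2"
    using assms[OF e] by blast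
  obtain s where s: "simple_fun \<Omega> M s" "\<And>\<omega>. \<omega> \<in> \<Omega> \<Longrightarrow> \<bar>g \<omega> - s \<omega>\<bar> \<le> e / 2"
    using B_spaceE[OF g(1) e] by blast
  have "\<bar>f \<omega> - s \<omega>\<bar> \<le> e" if "\<omega> \<in> \<Omega>" for \<omega>
    using g(2)[OF that] s(2)[OF that] by linarith
  with s(1) show "\<exists>s. simple_fun \<Omega> M s \<and> (\<forall>\<omega>\<in>\<Omega>. \<bar>f \<omega> - s \<omega>\<bar> \<le> e)"
    by blast
qed

text \<open>Superlevel sets of a uniform limit need not lie in the field. A gap between the
  thresholds leaves room for a set of the field: an approximant with error
  \<open>(b - a) / 2\<close> is cut at the midpoint.\<close>

lemma B_space_superlevel:
  assumes "f \<in> B_space \<Omega> M" "a < b"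
  obtains E where "E \<in> M" "\<And>\<omega>. \<omega> \<in> \<Omega> \<Longrightarrow> b \<le> f \<omega> \<Longrightarrow> \<omega> \<in> E" "\<And>\<omega>. \<omega> \<in> E \<Longrightarrow> a \<le> f \<omega>"
proof -
  obtain s where s: "simple_fun \<Omega> M s" "\<And>\<omega>. \<omega> \<in> \<Omega> \<Longrightarrow> \<bar>f \<omega> - s \<omega>\<bar> \<le> (b - a) / 2"
    using B_spaceE[OF assms(1), of "(b - a) / 2"] assms(2) by auto
  define E where "E = {\<omega>\<in>\<Omega>. (a + b) / 2 \<le> s \<omega>}"
  have "E \<in> M"
    unfolding E_def using s(1) by (intro fin_meas_preimage) (simp add: simple_fun_iff_fin_meas)
  moreover have "\<omega> \<in> E" if "\<omega> \<in> \<Omega>" "b \<le> f \<omega>" for \<omega>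
    using abs_le_D1[OF s(2)[OF that(1)]] that by (auto simp: E_def field_simps)
  moreover have "a \<le> f \<omega>" if "\<omega> \<in> E" for \<omega>
  proof -
    have "\<omega> \<in> \<Omega>" "(a + b) / 2 \<le> s \<omega>"
      using that by (auto simp: E_def)
    with abs_le_D2[OF s(2)[of \<omega>]] show ?thesis
      by (simp add: field_simps)
  qed
  ultimately show ?thesis
    using that by blast
qed

end

section \<open>Means\<close>

text \<open>Normalised positive linear functionals on B: the common form of integrals, point
  evaluations and functionals built from cones. Monotonicity is tested on \<open>\<Omega>\<close>
  only, so values off \<open>\<Omega>\<close> cannot matter.\<close>

definition mean :: "'w set \<Rightarrow> 'w set set \<Rightarrow> (('w \<Rightarrow> real) \<Rightarrow> real) \<Rightarrow> bool" where
  "mean \<Omega> A L \<longleftrightarrow>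
     (\<forall>f\<in>B_space \<Omega> A. \<forall>g\<in>B_space \<Omega> A. L (\<lambda>\<omega>. f \<omega> + g \<omega>) = L f + L g) \<and>
     (\<forall>c. \<forall>f\<in>B_space \<Omega> A. L (\<lambda>\<omega>. c * f \<omega>) = c * L f) \<and>
     (\<forall>f\<in>B_space \<Omega> A. \<forall>g\<in>B_space \<Omega> A. (\<forall>\<omega>\<in>\<Omega>. f \<omega> \<le> g \<omega>) \<longrightarrow> L f \<le> L g) \<and>
     L (\<lambda>_. 1) = 1"

lemma mean_add:
  "mean \<Omega> A L \<Longrightarrow> f \<in> B_space \<Omega> A \<Longrightarrow> g \<in> B_space \<Omega> A \<Longrightarrow> L (\<lambda>\<omega>. f \<omega> + g \<omega>) = L f + L g"
  and mean_cmult: "mean \<Omega> A L \<Longrightarrow> f \<in> B_space \<Omega> A \<Longrightarrow> L (\<lambda>\<omega>. c * f \<omega>) = c * L f"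
  and mean_mono: "mean \<Omega> A L \<Longrightarrow> f \<in> B_space \<Omega> A \<Longrightarrow> g \<in> B_space \<Omega> A \<Longrightarrow>
      (\<And>\<omega>. \<omega> \<in> \<Omega> \<Longrightarrow> f \<omega> \<le> g \<omega>) \<Longrightarrow> L f \<le> L g"
  and mean_one: "mean \<Omega> A L \<Longrightarrow> L (\<lambda>_. 1) = 1"
  by (simp_all add: mean_def)

lemma mean_cong:
  assumes "mean \<Omega> A L" "f \<in> B_space \<Omega> A" "g \<in> B_space \<Omega> A" "\<And>\<omega>. \<omega> \<in> \<Omega> \<Longrightarrow> f \<omega> = g \<omega>"
  shows "L f = L g"
  using mean_mono[OF assms(1-3)] mean_mono[OF assms(1,3,2)] assms(4) by (simp add: order_antisym)

lemma mean_subfield: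
  assumes "mean \<Omega> A L" "M \<subseteq> A"
  shows "mean \<Omega> M L"
  using assms(1) subsetD[OF B_space_mono[OF assms(2)], of _ \<Omega>] by (simp add: mean_def)

lemma mean_eval: "\<omega> \<in> \<Omega> \<Longrightarrow> mean \<Omega> A (\<lambda>f. f \<omega>)"
  by (simp add: mean_def)

lemma mean_convex_combination:
  assumes "\<And>k. k \<in> J \<Longrightarrow> mean \<Omega> A (L k)" "\<And>k. k \<in> J \<Longrightarrow> 0 \<le> l k" "(\<Sum>k\<in>J. l k) = (1::real)"
  shows "mean \<Omega> A (\<lambda>f. \<Sum>k\<in>J. l k * L k f)"
proof -
  have "(\<Sum>k\<in>J. l k * L k (\<lambda>\<omega>. f \<omega> + g \<omega>)) = (\<Sum>k\<in>J. l k * L k f) + (\<Sum>k\<in>J. l k * L k g)"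
    if "f \<in> B_space \<Omega> A" "g \<in> B_space \<Omega> A" for f g
    using mean_add[OF assms(1) that] by (simp add: sum.distrib distrib_left)
  moreover have "(\<Sum>k\<in>J. l k * L k (\<lambda>\<omega>. c * f \<omega>)) = c * (\<Sum>k\<in>J. l k * L k f)"
    if "f \<in> B_space \<Omega> A" for f c
    using mean_cmult[OF assms(1) that] by (simp add: sum_distrib_left mult.left_commute)
  moreover have "(\<Sum>k\<in>J. l k * L k f) \<le> (\<Sum>k\<in>J. l k * L k g)"
    if "f \<in> B_space \<Omega> A" "g \<in> B_space \<Omega> A" "\<forall>\<omega>\<in>\<Omega>. f \<omega> \<le> g \<omega>" for f g
    using mean_mono[OF assms(1) that(1,2)] that(3) assms(2) by (intro sum_mono mult_left_mono) auto
  moreover have "(\<Sum>k\<in>J. l k * L k (\<lambda>_. 1)) = 1"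
    using mean_one[OF assms(1)] assms(3) by simp
  ultimately show ?thesis
    unfolding mean_def by blast
qed

context algebra
begin

lemma mean_const: "mean \<Omega> M L \<Longrightarrow> L (\<lambda>_. c) = c"
  using mean_cmult[OF _ B_space_const, of L c 1] mean_one[of \<Omega> M L] by simp

lemma mean_diff:
  assumes "mean \<Omega> M L" "f \<in> B_space \<Omega> M" "g \<in> B_space \<Omega> M"
  shows "L (\<lambda>\<omega>. f \<omega> - g \<omega>) = L f - L g"
  using mean_add[OF assms(1,2) B_space_cmult[OF assms(3), of "-1"]] mean_cmult[OF assms(1,3), of "-1"]
  by simp

lemma mean_sum:
  assumes "mean \<Omega> M L" "\<And>i. i \<in> I \<Longrightarrow> f i \<in> B_space \<Omega> M"
  shows "L (\<lambda>\<omega>. \<Sum>i\<in>I. f i \<omega>) = (\<Sum>i\<in>I. L (f i))"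
  using assms(2)
proof (induction I rule: infinite_finite_induct)
  case (insert i I)
  then show ?case
    using mean_add[OF assms(1), of "f i" "\<lambda>\<omega>. \<Sum>i\<in>I. f i \<omega>"] B_space_sum[of I f] by simp
qed (use mean_const[OF assms(1), of 0] in auto)

lemma mean_close:
  assumes L: "mean \<Omega> M L" and fg: "f \<in> B_space \<Omega> M" "g \<in> B_space \<Omega> M"
    and le: "\<And>\<omega>. \<omega> \<in> \<Omega> \<Longrightarrow> \<bar>f \<omega> - g \<omega>\<bar> \<le> e"
  shows "\<bar>L f - L g\<bar> \<le> e"
proof -
  have "L (\<lambda>\<omega>. f \<omega> - g \<omega>) \<le> L (\<lambda>_. e)" "L (\<lambda>\<omega>. g \<omega> - f \<omega>) \<le> L (\<lambda>_. e)"
    using le by (intro mean_mono[OF L] B_space_diff B_space_const fg; fastforce simp: abs_le_iff)+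
  then show ?thesis
    using mean_diff[OF L fg] mean_diff[OF L fg(2,1)] mean_const[OF L, of e] by simp
qed

lemma mean_abs_le:
  assumes "mean \<Omega> M L" "f \<in> B_space \<Omega> M" "\<And>\<omega>. \<omega> \<in> \<Omega> \<Longrightarrow> \<bar>f \<omega>\<bar> \<le> b"
  shows "\<bar>L f\<bar> \<le> b"
  using mean_close[OF assms(1,2) B_space_const, of 0 b] mean_const[OF assms(1), of 0] assms(3) by simp

lemma mean_simple:
  assumes L: "mean \<Omega> M L" and s: "simple_fun \<Omega> M s"
  shows "L s = (\<Sum>v\<in>s ` \<Omega>. v * L (indicator {\<omega>\<in>\<Omega>. s \<omega> = v}))"
proof -
  have fin: "finite (s ` \<Omega>)"
    using s by (simp add: simple_fun_def)
  have B: "indicator {\<omega>\<in>\<Omega>. s \<omega> = v} \<in> B_space \<Omega> M" if "v \<in> s ` \<Omega>" for v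
    using s that by (intro B_space_indicator) (auto simp: simple_fun_def)
  have "L s = L (\<lambda>\<omega>. \<Sum>v\<in>s ` \<Omega>. v * indicator {\<omega>\<in>\<Omega>. s \<omega> = v} \<omega>)"
  proof (rule mean_cong[OF L B_spaceI_simple[OF s]])
    show "(\<lambda>\<omega>. \<Sum>v\<in>s ` \<Omega>. v * indicator {\<omega>\<in>\<Omega>. s \<omega> = v} \<omega>) \<in> B_space \<Omega> M"
      by (intro B_space_sum B_space_cmult B)
    fix \<omega> assume w: "\<omega> \<in> \<Omega>"
    have "(\<Sum>v\<in>s ` \<Omega>. v * indicator {\<omega>\<in>\<Omega>. s \<omega> = v} \<omega>) = (\<Sum>v\<in>s ` \<Omega>. if s \<omega> = v then v else 0)"
      using w by (intro sum.cong) (auto simp: indicator_def)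
    also have "\<dots> = s \<omega>"
      using fin w by simp
    finally show "s \<omega> = (\<Sum>v\<in>s ` \<Omega>. v * indicator {\<omega>\<in>\<Omega>. s \<omega> = v} \<omega>)"
      by simp
  qed
  also have "\<dots> = (\<Sum>v\<in>s ` \<Omega>. L (\<lambda>\<omega>. v * indicator {\<omega>\<in>\<Omega>. s \<omega> = v} \<omega>))"
    by (intro mean_sum[OF L] B_space_cmult B)
  also have "\<dots> = (\<Sum>v\<in>s ` \<Omega>. v * L (indicator {\<omega>\<in>\<Omega>. s \<omega> = v}))"
    by (intro sum.cong refl mean_cmult[OF L] B)
  finally show ?thesis .
qed

text \<open>On simple functions a mean is a finite combination of its indicator values, and it is
  1-Lipschitz for the sup norm, so agreement on indicators passes to uniform limits.\<close>

lemma mean_unique: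
  assumes L: "mean \<Omega> M L" "mean \<Omega> M L'"
    and eq: "\<And>E. E \<in> M \<Longrightarrow> L (indicator E) = L' (indicator E)"
    and f: "f \<in> B_space \<Omega> M"
  shows "L f = L' f"
proof -
  have "\<bar>L f - L' f\<bar> \<le> e" if e: "0 < e" for e
  proof -
    obtain s where s: "simple_fun \<Omega> M s" "\<And>\<omega>. \<omega> \<in> \<Omega> \<Longrightarrow> \<bar>f \<omega> - s \<omega>\<bar> \<le> e / 2"
      using B_spaceE[OF f, of "e / 2"] e by auto
    have "L s = L' s"
      unfolding mean_simple[OF L(1) s(1)] mean_simple[OF L(2) s(1)]
      using s(1) by (intro sum.cong refl arg_cong2[where f = "(*)"] eq) (auto simp: simple_fun_def)
    then show ?thesis
      using mean_close[OF L(1) f B_spaceI_simple[OF s(1)] s(2)]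
        mean_close[OF L(2) f B_spaceI_simple[OF s(1)] s(2)] by linarith
  qed
  then have "\<bar>L f - L' f\<bar> \<le> 0"
    by (rule field_le_epsilon) simp
  then show ?thesis
    by simp
qed

lemma mean_imp_pba:
  assumes L: "mean \<Omega> M L"
  shows "pba \<Omega> M (\<lambda>E. L (indicator E))"
proof -
  have "L (indicator (E \<union> F)) = L (indicator E) + L (indicator F)"
    if "E \<in> M" "F \<in> M" "E \<inter> F = {}" for E F
  proof -
    have "indicator (E \<union> F) = (\<lambda>\<omega>. indicator E \<omega> + indicator F \<omega> :: real)"
      using that(3) by (auto simp: indicator_def fun_eq_iff)
    then show ?thesis
      using mean_add[OF L B_space_indicator[OF that(1)] B_space_indicator[OF that(2)]] by simp
  qed
  moreover have "0 \<le> L (indicator E)" if "E \<in> M" for E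
    using mean_mono[OF L B_space_const[of 0] B_space_indicator[OF that]] mean_const[OF L, of 0] by simp
  moreover have "L (indicator \<Omega>) = 1"
    using mean_cong[OF L B_space_indicator[OF top] B_space_const[of 1]] mean_one[OF L] by simp
  ultimately show ?thesis
    by (auto simp: pba_def fin_add_def)
qed

end

section \<open>The integral against a finitely additive probability\<close>

context algebra
begin

section \<open>Finitely additive probabilities and their integrals\<close>

lemma pba_Un:
  "pba \<Omega> M P \<Longrightarrow> E \<in> M \<Longrightarrow> F \<in> M \<Longrightarrow> E \<inter> F = {} \<Longrightarrow> P (E \<union> F) = P E + P F"
  unfolding pba_def fin_add_def by blast

lemma pba_empty: "pba \<Omega> M P \<Longrightarrow> P {} = 0"
  using pba_Un[of P "{}" "{}"] by simp

lemma pba_finite_Union: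
  assumes P: "pba \<Omega> M P" and "finite J" "\<And>j. j \<in> J \<Longrightarrow> D j \<in> M" "disjoint_family_on D J"
  shows "P (\<Union>j\<in>J. D j) = (\<Sum>j\<in>J. P (D j))"
  using assms(2-)
proof (induction J rule: finite_induct)
  case empty
  then show ?case
    by (simp add: pba_empty[OF P])
next
  case (insert j J)
  have "P (D j \<union> (\<Union>j\<in>J. D j)) = P (D j) + P (\<Union>j\<in>J. D j)"
    using insert.prems insert.hyps
    by (intro pba_Un[OF P] finite_UN) (fastforce simp: disjoint_family_on_def)+
  moreover have "P (\<Union>j\<in>J. D j) = (\<Sum>j\<in>J. P (D j))"
    using insert.prems by (intro insert.IH) (auto simp: disjoint_family_on_def)
  ultimately show ?case
    using insert.hyps by simp
qed

lemma pba_mono: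
  assumes P: "pba \<Omega> M P" and E: "E \<in> M" "F \<in> M" "E \<subseteq> F"
  shows "P E \<le> P F"
proof -
  have "P (E \<union> (F - E)) = P E + P (F - E)"
    using E by (intro pba_Un[OF P]) auto
  moreover have "0 \<le> P (F - E)"
    using P E unfolding pba_def by blast
  moreover have "E \<union> (F - E) = F"
    using E by auto
  ultimately show ?thesis
    by simp
qed

lemma pba_Diff:
  assumes P: "pba \<Omega> M P" and E: "E \<in> M"
  shows "P (\<Omega> - E) = 1 - P E"
proof -
  have "P (E \<union> (\<Omega> - E)) = P E + P (\<Omega> - E)"
    using E by (intro pba_Un[OF P]) auto
  moreover have "E \<union> (\<Omega> - E) = \<Omega>"
    using E sets_into_space by auto
  ultimately show ?thesis
    using P by (simp add: pba_def)
qed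

lemma pba_imp_ba:
  assumes P: "pba \<Omega> M P"
  shows "ba \<Omega> M P"
proof -
  have "\<bar>P E\<bar> \<le> 1" if "E \<in> M" for E
    using pba_mono[OF P that top] P that sets_into_space unfolding pba_def by auto
  with P show ?thesis
    unfolding ba_def pba_def by blast
qed

text \<open>An integral may be computed on the finer partition given by \<open>q\<close>. With
  \<open>q\<close> a pair, two simple functions share one partition, which makes additivity and
  monotonicity termwise facts about sums.\<close>

lemma simple_integral_comp:
  assumes P: "pba \<Omega> M P" and q: "fin_meas \<Omega> M q"
  shows "simple_integral \<Omega> P (\<lambda>\<omega>. \<phi> (q \<omega>)) = (\<Sum>b\<in>q ` \<Omega>. \<phi> b * P {\<omega>\<in>\<Omega>. q \<omega> = b})"
proof -
  have fin: "finite (q ` \<Omega>)"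
    using q by (simp add: fin_meas_def)
  have "P {\<omega>\<in>\<Omega>. \<phi> (q \<omega>) = v} = (\<Sum>b\<in>{b\<in>q ` \<Omega>. \<phi> b = v}. P {\<omega>\<in>\<Omega>. q \<omega> = b})" for v
  proof -
    have "{\<omega>\<in>\<Omega>. \<phi> (q \<omega>) = v} = (\<Union>b\<in>{b\<in>q ` \<Omega>. \<phi> b = v}. {\<omega>\<in>\<Omega>. q \<omega> = b})"
      by auto
    then show ?thesis
      using fin q by (auto intro!: pba_finite_Union[OF P] simp: disjoint_family_on_def fin_meas_def)
  qed
  then have "simple_integral \<Omega> P (\<lambda>\<omega>. \<phi> (q \<omega>)) =
      (\<Sum>v\<in>\<phi> ` q ` \<Omega>. \<Sum>b\<in>{b\<in>q ` \<Omega>. \<phi> b = v}. \<phi> b * P {\<omega>\<in>\<Omega>. q \<omega> = b})"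
    unfolding simple_integral_def by (simp add: image_image sum_distrib_left)
  also have "\<dots> = (\<Sum>b\<in>q ` \<Omega>. \<phi> b * P {\<omega>\<in>\<Omega>. q \<omega> = b})"
    by (rule sum.image_gen[OF fin, symmetric])
  finally show ?thesis .
qed

lemma simple_integral_add:
  assumes P: "pba \<Omega> M P" and s: "simple_fun \<Omega> M s" "simple_fun \<Omega> M r"
  shows "simple_integral \<Omega> P (\<lambda>\<omega>. s \<omega> + r \<omega>) = simple_integral \<Omega> P s + simple_integral \<Omega> P r"
proof -
  have q: "fin_meas \<Omega> M (\<lambda>\<omega>. (s \<omega>, r \<omega>))"
    using s by (simp add: simple_fun_iff_fin_meas fin_meas_pair)
  show ?thesis
    using simple_integral_comp[OF P q, of fst] simple_integral_comp[OF P q, of snd]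
      simple_integral_comp[OF P q, of "\<lambda>p. fst p + snd p"]
    by (simp add: distrib_right sum.distrib)
qed

lemma simple_integral_cmult:
  assumes P: "pba \<Omega> M P" and s: "simple_fun \<Omega> M s"
  shows "simple_integral \<Omega> P (\<lambda>\<omega>. c * s \<omega>) = c * simple_integral \<Omega> P s"
proof -
  have q: "fin_meas \<Omega> M s"
    using s by (simp add: simple_fun_iff_fin_meas)
  show ?thesis
    using simple_integral_comp[OF P q, of "\<lambda>x. x"] simple_integral_comp[OF P q, of "\<lambda>x. c * x"]
    by (simp add: sum_distrib_left mult.assoc)
qed

lemma simple_integral_le:
  assumes P: "pba \<Omega> M P" and s: "simple_fun \<Omega> M s" "simple_fun \<Omega> M r"
    and le: "\<And>\<omega>. \<omega> \<in> \<Omega> \<Longrightarrow> s \<omega> \<le> r \<omega> + e"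
  shows "simple_integral \<Omega> P s \<le> simple_integral \<Omega> P r + e"
proof -
  have q: "fin_meas \<Omega> M (\<lambda>\<omega>. (s \<omega>, r \<omega>))"
    using s by (simp add: simple_fun_iff_fin_meas fin_meas_pair)
  let ?q = "\<lambda>\<omega>. (s \<omega>, r \<omega>)"
  \<comment> \<open>The weights add up to \<open>P \<Omega> = 1\<close>, which turns the pointwise
    slack \<open>e\<close> into exactly \<open>e\<close> after integration.\<close>
  have "(\<Sum>b\<in>?q ` \<Omega>. P {\<omega>\<in>\<Omega>. ?q \<omega> = b}) = P (\<Union>b\<in>?q ` \<Omega>. {\<omega>\<in>\<Omega>. ?q \<omega> = b})"
    using q unfolding fin_meas_def
    by (intro pba_finite_Union[OF P, symmetric]) (auto simp: disjoint_family_on_def)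
  also have "(\<Union>b\<in>?q ` \<Omega>. {\<omega>\<in>\<Omega>. ?q \<omega> = b}) = \<Omega>"
    by auto
  finally have one: "(\<Sum>b\<in>?q ` \<Omega>. P {\<omega>\<in>\<Omega>. ?q \<omega> = b}) = 1"
    using P by (simp add: pba_def)
  have "simple_integral \<Omega> P s = (\<Sum>b\<in>?q ` \<Omega>. fst b * P {\<omega>\<in>\<Omega>. ?q \<omega> = b})"
    using simple_integral_comp[OF P q, of fst] by simp
  also have "\<dots> \<le> (\<Sum>b\<in>?q ` \<Omega>. (snd b + e) * P {\<omega>\<in>\<Omega>. ?q \<omega> = b})"
    using P q le unfolding pba_def fin_meas_def by (intro sum_mono mult_right_mono) auto
  also have "\<dots> = (\<Sum>b\<in>?q ` \<Omega>. snd b * P {\<omega>\<in>\<Omega>. ?q \<omega> = b}) + e * (\<Sum>b\<in>?q ` \<Omega>. P {\<omega>\<in>\<Omega>. ?q \<omega> = b})"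
    by (simp only: distrib_right sum.distrib sum_distrib_left)
  also have "\<dots> = simple_integral \<Omega> P r + e"
    using simple_integral_comp[OF P q, of snd] one by simp
  finally show ?thesis .
qed

lemma simple_integral_close:
  assumes P: "pba \<Omega> M P" and s: "simple_fun \<Omega> M s" "simple_fun \<Omega> M r"
    and "\<And>\<omega>. \<omega> \<in> \<Omega> \<Longrightarrow> \<bar>s \<omega> - r \<omega>\<bar> \<le> e"
  shows "\<bar>simple_integral \<Omega> P s - simple_integral \<Omega> P r\<bar> \<le> e"
proof -
  have "s \<omega> \<le> r \<omega> + e" "r \<omega> \<le> s \<omega> + e" if "\<omega> \<in> \<Omega>" for \<omega>
    using assms(4)[OF that] by (auto simp: abs_le_iff)
  then show ?thesis
    using simple_integral_le[OF P s, of e] simple_integral_le[OF P s(2,1), of e]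
    by (simp add: abs_le_iff)
qed

text \<open>The integrals of the approximants picked by \<open>SOME\<close> form a Cauchy sequence,
  so the \<open>lim\<close> in \<open>fa_integral\<close> is a genuine limit. Comparing the sequence
  with the fixed \<open>r\<close> and passing to the limit gives the bound.\<close>

lemma fa_integral_close_simple:
  assumes P: "pba \<Omega> M P" and f: "f \<in> B_space \<Omega> M" and r: "simple_fun \<Omega> M r"
    and le: "\<And>\<omega>. \<omega> \<in> \<Omega> \<Longrightarrow> \<bar>f \<omega> - r \<omega>\<bar> \<le> e"
  shows "\<bar>fa_integral \<Omega> M P f - simple_integral \<Omega> P r\<bar> \<le> e"
proof -
  define s where "s = approx_simple \<Omega> M f"
  have s: "simple_fun \<Omega> M (s n) \<and> (\<forall>\<omega>\<in>\<Omega>. \<bar>f \<omega> - s n \<omega>\<bar> \<le> 1 / (real n + 1))" for n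
  proof -
    have "\<exists>s. simple_fun \<Omega> M s \<and> (\<forall>\<omega>\<in>\<Omega>. \<bar>f \<omega> - s \<omega>\<bar> \<le> 1 / (real n + 1))"
      using f by (simp add: B_space_def)
    from someI_ex[OF this] show ?thesis
      unfolding s_def approx_simple_def .
  qed
  define a where "a n = simple_integral \<Omega> P (s n)" for n
  \<comment> \<open>Serves twice: \<open>r' = s n\<close> gives the Cauchy property,
    \<open>r' = r\<close> the final bound.\<close>
  have a_close: "\<bar>a n - simple_integral \<Omega> P r'\<bar> \<le> 1 / (real n + 1) + e'"
    if "simple_fun \<Omega> M r'" "\<And>\<omega>. \<omega> \<in> \<Omega> \<Longrightarrow> \<bar>f \<omega> - r' \<omega>\<bar> \<le> e'" for n r' e'
    unfolding a_def
  proof (rule simple_integral_close[OF P _ that(1)])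
    fix \<omega> assume "\<omega> \<in> \<Omega>"
    then show "\<bar>s n \<omega> - r' \<omega>\<bar> \<le> 1 / (real n + 1) + e'"
      using s[of n] that(2)[of \<omega>] by fastforce
  qed (use s in blast)
  have lim0: "(\<lambda>n. 1 / (real n + 1)) \<longlonglongrightarrow> 0"
    using LIMSEQ_inverse_real_of_nat by (simp add: inverse_eq_divide add.commute)
  have "Cauchy a"
    unfolding Cauchy_altdef
  proof (intro allI impI)
    fix e :: real assume "0 < e"
    then obtain K where K: "\<And>n. n \<ge> K \<Longrightarrow> 1 / (real n + 1) < e / 2"
      using order_tendstoD(2)[OF lim0, of "e / 2"] by (auto simp: eventually_sequentially)
    have "dist (a m) (a n) < e" if "m \<ge> K" "n > m" for m n
    proof -
      have "\<bar>a m - a n\<bar> \<le> 1 / (real m + 1) + 1 / (real n + 1)"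
        using a_close[of "s n" "1 / (real n + 1)" m] s[of n] unfolding a_def by blast
      then show ?thesis
        using K[of m] K[of n] that by (simp add: dist_real_def)
    qed
    then show "\<exists>K. \<forall>m\<ge>K. \<forall>n>m. dist (a m) (a n) < e"
      by blast
  qed
  then have "a \<longlonglongrightarrow> fa_integral \<Omega> M P f"
    unfolding fa_integral_def a_def s_def by (simp add: Cauchy_convergent convergent_LIMSEQ_iff[symmetric])
  then have "(\<lambda>n. \<bar>a n - simple_integral \<Omega> P r\<bar>) \<longlonglongrightarrow> \<bar>fa_integral \<Omega> M P f - simple_integral \<Omega> P r\<bar>"
    by (intro tendsto_intros)
  moreover have "(\<lambda>n. 1 / (real n + 1) + e) \<longlonglongrightarrow> 0 + e"
    by (intro tendsto_intros lim0)
  ultimately show ?thesis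
    using a_close[OF r le] by (intro LIMSEQ_le[of _ _ _ "e"]) auto
qed

lemma fa_integral_simple:
  assumes P: "pba \<Omega> M P" and s: "simple_fun \<Omega> M s"
  shows "fa_integral \<Omega> M P s = simple_integral \<Omega> P s"
  using fa_integral_close_simple[OF P B_spaceI_simple[OF s] s, of 0] by simp

lemma fa_integral_indicator:
  assumes P: "pba \<Omega> M P" and E: "E \<in> M"
  shows "fa_integral \<Omega> M P (indicator E) = P E"
proof -
  have q: "fin_meas \<Omega> M (\<lambda>\<omega>. \<omega> \<in> E)"
    using fin_meas_comp[OF fin_meas_indicator[OF E], of "\<lambda>x. x = 1"] by (simp add: indicator_def)
  have [simp]: "{\<omega> \<in> \<Omega>. \<omega> \<in> E} = E" "E \<inter> \<Omega> = E"
    using E sets_into_space by auto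
  have ind: "(indicator E :: 'a \<Rightarrow> real) = (\<lambda>\<omega>. of_bool (\<omega> \<in> E))"
    by (auto simp: indicator_def)
  have "fa_integral \<Omega> M P (indicator E) = simple_integral \<Omega> P (\<lambda>\<omega>. of_bool (\<omega> \<in> E))"
    unfolding ind[symmetric]
    using E by (intro fa_integral_simple[OF P]) (simp add: simple_fun_iff_fin_meas fin_meas_indicator)
  also have "\<dots> = (\<Sum>b\<in>(\<lambda>\<omega>. \<omega> \<in> E) ` \<Omega>. of_bool b * P {\<omega>\<in>\<Omega>. (\<omega> \<in> E) = b})"
    by (rule simple_integral_comp[OF P q])
  \<comment> \<open>Summing over both truth values is harmless: one that is not attained on
    \<open>\<Omega>\<close> has an empty level set, of probability 0.\<close>
  also have "\<dots> = (\<Sum>b\<in>UNIV. of_bool b * P {\<omega>\<in>\<Omega>. (\<omega> \<in> E) = b})"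
  proof (rule sum.mono_neutral_left)
    show "\<forall>b\<in>UNIV - (\<lambda>\<omega>. \<omega> \<in> E) ` \<Omega>. of_bool b * P {\<omega>\<in>\<Omega>. (\<omega> \<in> E) = b} = 0"
    proof
      fix b assume "b \<in> UNIV - (\<lambda>\<omega>. \<omega> \<in> E) ` \<Omega>"
      then have "{\<omega>\<in>\<Omega>. (\<omega> \<in> E) = b} = {}"
        by auto
      with pba_empty[OF P] show "of_bool b * P {\<omega>\<in>\<Omega>. (\<omega> \<in> E) = b} = 0"
        by (metis mult_zero_right)
    qed
  qed auto
  also have "\<dots> = P E"
    by (simp add: UNIV_bool)
  finally show ?thesis .
qed

lemma mean_fa_integral:
  assumes P: "pba \<Omega> M P"
  shows "mean \<Omega> M (fa_integral \<Omega> M P)"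
proof -
  let ?I = "fa_integral \<Omega> M P" and ?J = "simple_integral \<Omega> P"
  \<comment> \<open>Additivity and homogeneity are obtained only up to a multiple of each
    \<open>e\<close>; this turns such estimates into equalities.\<close>
  have eqI: "x = y" if "\<And>e. 0 < e \<Longrightarrow> \<bar>x - y\<bar> \<le> K * e" for x y K :: real
  proof (rule ccontr)
    assume "x \<noteq> y"
    then have d: "0 < \<bar>x - y\<bar>" by simp
    have "\<bar>x - y\<bar> \<le> K * (\<bar>x - y\<bar> / (2 * (\<bar>K\<bar> + 1)))"
      by (rule that) (use d in \<open>simp add: field_simps\<close>)
    also have "\<dots> \<le> \<bar>K\<bar> * (\<bar>x - y\<bar> / (2 * (\<bar>K\<bar> + 1)))"
      by (intro mult_right_mono) auto
    also have "\<dots> \<le> \<bar>x - y\<bar> / 2"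
      using d by (simp add: field_simps)
    finally show False
      using d by simp
  qed
  have "?I (\<lambda>\<omega>. f \<omega> + g \<omega>) = ?I f + ?I g" if f: "f \<in> B_space \<Omega> M" and g: "g \<in> B_space \<Omega> M" for f g
  proof (rule eqI[where K = 4])
    fix e :: real assume e: "0 < e"
    obtain s where s: "simple_fun \<Omega> M s" "\<And>\<omega>. \<omega> \<in> \<Omega> \<Longrightarrow> \<bar>f \<omega> - s \<omega>\<bar> \<le> e"
      using B_spaceE[OF f e] by blast
    obtain r where r: "simple_fun \<Omega> M r" "\<And>\<omega>. \<omega> \<in> \<Omega> \<Longrightarrow> \<bar>g \<omega> - r \<omega>\<bar> \<le> e"
      using B_spaceE[OF g e] by blast
    have "simple_fun \<Omega> M (\<lambda>\<omega>. s \<omega> + r \<omega>)"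
      using fin_meas_comp[OF fin_meas_pair, of s r "\<lambda>p. fst p + snd p"] s(1) r(1)
      by (simp add: simple_fun_iff_fin_meas)
    then have "\<bar>?I (\<lambda>\<omega>. f \<omega> + g \<omega>) - ?J (\<lambda>\<omega>. s \<omega> + r \<omega>)\<bar> \<le> 2 * e"
      using s(2) r(2) by (intro fa_integral_close_simple[OF P B_space_add[OF f g]]) fastforce+
    moreover have "\<bar>?I f - ?J s\<bar> \<le> e" "\<bar>?I g - ?J r\<bar> \<le> e"
      using s r f g by (auto intro!: fa_integral_close_simple[OF P])
    ultimately show "\<bar>?I (\<lambda>\<omega>. f \<omega> + g \<omega>) - (?I f + ?I g)\<bar> \<le> 4 * e"
      unfolding simple_integral_add[OF P s(1) r(1)] by linarith
  qed
  moreover have "?I (\<lambda>\<omega>. c * f \<omega>) = c * ?I f" if f: "f \<in> B_space \<Omega> M" for f c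
  proof (rule eqI[where K = "2 * \<bar>c\<bar>"])
    fix e :: real assume e: "0 < e"
    obtain s where s: "simple_fun \<Omega> M s" "\<And>\<omega>. \<omega> \<in> \<Omega> \<Longrightarrow> \<bar>f \<omega> - s \<omega>\<bar> \<le> e"
      using B_spaceE[OF f e] by blast
    have "simple_fun \<Omega> M (\<lambda>\<omega>. c * s \<omega>)"
      using fin_meas_comp[of s] s(1) by (simp add: simple_fun_iff_fin_meas)
    then have "\<bar>?I (\<lambda>\<omega>. c * f \<omega>) - ?J (\<lambda>\<omega>. c * s \<omega>)\<bar> \<le> \<bar>c\<bar> * e"
      using s(2) by (intro fa_integral_close_simple[OF P B_space_cmult[OF f]])
        (auto simp: right_diff_distrib[symmetric] abs_mult intro!: mult_left_mono)
    moreover have "\<bar>c * ?I f - c * ?J s\<bar> \<le> \<bar>c\<bar> * e"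
      using fa_integral_close_simple[OF P f s]
      by (auto simp: right_diff_distrib[symmetric] abs_mult intro!: mult_left_mono)
    ultimately show "\<bar>?I (\<lambda>\<omega>. c * f \<omega>) - c * ?I f\<bar> \<le> 2 * \<bar>c\<bar> * e"
      unfolding simple_integral_cmult[OF P s(1)] by linarith
  qed
  moreover have "?I f \<le> ?I g"
    if f: "f \<in> B_space \<Omega> M" and g: "g \<in> B_space \<Omega> M" and le: "\<forall>\<omega>\<in>\<Omega>. f \<omega> \<le> g \<omega>" for f g
  proof (rule field_le_epsilon)
    fix e :: real assume "0 < e"
    then have e: "0 < e / 4" by simp
    obtain s where s: "simple_fun \<Omega> M s" "\<And>\<omega>. \<omega> \<in> \<Omega> \<Longrightarrow> \<bar>f \<omega> - s \<omega>\<bar> \<le> e / 4"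
      using B_spaceE[OF f e] by blast
    obtain r where r: "simple_fun \<Omega> M r" "\<And>\<omega>. \<omega> \<in> \<Omega> \<Longrightarrow> \<bar>g \<omega> - r \<omega>\<bar> \<le> e / 4"
      using B_spaceE[OF g e] by blast
    have "s \<omega> \<le> r \<omega> + e / 2" if "\<omega> \<in> \<Omega>" for \<omega>
      using abs_le_D2[OF s(2)[OF that]] abs_le_D1[OF r(2)[OF that]] bspec[OF le that] by simp
    then have "?J s \<le> ?J r + e / 2"
      by (intro simple_integral_le[OF P s(1) r(1)])
    moreover have "\<bar>?I f - ?J s\<bar> \<le> e / 4" "\<bar>?I g - ?J r\<bar> \<le> e / 4"
      by (rule fa_integral_close_simple[OF P f s], assumption, rule fa_integral_close_simple[OF P g r])
    ultimately show "?I f \<le> ?I g + e"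
      by linarith
  qed
  moreover have "?I (\<lambda>_. 1) = 1"
  proof -
    have "simple_fun \<Omega> M (\<lambda>_. 1)"
      by (simp add: simple_fun_iff_fin_meas fin_meas_const)
    then have "?I (\<lambda>_. 1) = ?J (\<lambda>_. 1)"
      by (rule fa_integral_simple[OF P])
    also have "\<dots> = 1"
    \<comment> \<open>The empty space is impossible, since \<open>P {} = 0\<close> and
      \<open>P \<Omega> = 1\<close>; on a nonempty one the constant has the single level set
      \<open>\<Omega>\<close>.\<close>
    proof (cases "\<Omega> = {}")
      case True
      then show ?thesis
        using P pba_empty[OF P] by (simp add: pba_def)
    next
      case False
      then show ?thesis
        using P by (simp add: simple_integral_def image_constant_conv pba_def)
    qed
    finally show ?thesis .
  qed
  ultimately show ?thesis
    unfolding mean_def by blast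
qed

text \<open>Representation of means by set functions, through uniqueness on indicators. It carries
  functionals built by cone extension or convex combination back to probabilities.\<close>

lemma mean_eq_fa_integral:
  assumes L: "mean \<Omega> M L" and P: "pba \<Omega> M P" and eq: "\<And>E. E \<in> M \<Longrightarrow> L (indicator E) = P E"
    and f: "f \<in> B_space \<Omega> M"
  shows "fa_integral \<Omega> M P f = L f"
  by (rule mean_unique[OF mean_fa_integral[OF P] L _ f]) (simp add: fa_integral_indicator[OF P] eq)

end

section \<open>Extending cones to means\<close>

text \<open>Functions in B are bounded on \<open>\<Omega>\<close>, so once the nonnegative ones
  belong to the cone, the constant 1 is an order unit. A mean that is nonnegative on the cone then
  exists exactly when the cone omits \<open>-1\<close>.\<close>

definition pos_cone :: "'w set \<Rightarrow> 'w set set \<Rightarrow> ('w \<Rightarrow> real) set \<Rightarrow> bool" where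
  "pos_cone \<Omega> A C \<longleftrightarrow> C \<subseteq> B_space \<Omega> A \<and>
     (\<forall>f\<in>C. \<forall>g\<in>C. (\<lambda>\<omega>. f \<omega> + g \<omega>) \<in> C) \<and>
     (\<forall>f\<in>C. \<forall>c\<ge>0. (\<lambda>\<omega>. c * f \<omega>) \<in> C) \<and>
     (\<forall>f\<in>B_space \<Omega> A. (\<forall>\<omega>\<in>\<Omega>. 0 \<le> f \<omega>) \<longrightarrow> f \<in> C)"

lemma pos_cone_sub: "pos_cone \<Omega> A C \<Longrightarrow> f \<in> C \<Longrightarrow> f \<in> B_space \<Omega> A"
  and pos_cone_add: "pos_cone \<Omega> A C \<Longrightarrow> f \<in> C \<Longrightarrow> g \<in> C \<Longrightarrow> (\<lambda>\<omega>. f \<omega> + g \<omega>) \<in> C"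
  and pos_cone_cmult: "pos_cone \<Omega> A C \<Longrightarrow> f \<in> C \<Longrightarrow> 0 \<le> c \<Longrightarrow> (\<lambda>\<omega>. c * f \<omega>) \<in> C"
  and pos_cone_nonneg: "pos_cone \<Omega> A C \<Longrightarrow> f \<in> B_space \<Omega> A \<Longrightarrow> (\<And>\<omega>. \<omega> \<in> \<Omega> \<Longrightarrow> 0 \<le> f \<omega>) \<Longrightarrow> f \<in> C"
  by (auto simp: pos_cone_def)

lemma pos_cone_Union_chain:
  assumes "\<C> \<noteq> {}" "\<And>C. C \<in> \<C> \<Longrightarrow> pos_cone \<Omega> A C"
    and chain: "\<And>C D. C \<in> \<C> \<Longrightarrow> D \<in> \<C> \<Longrightarrow> C \<subseteq> D \<or> D \<subseteq> C"
  shows "pos_cone \<Omega> A (\<Union>\<C>)"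
  unfolding pos_cone_def
proof (intro conjI ballI allI impI)
  show "\<Union>\<C> \<subseteq> B_space \<Omega> A"
    using pos_cone_sub[OF assms(2)] by blast
  fix f g assume "f \<in> \<Union>\<C>" "g \<in> \<Union>\<C>"
  then obtain C D where CD: "f \<in> C" "C \<in> \<C>" "g \<in> D" "D \<in> \<C>"
    by blast
  then have "(f \<in> C \<and> g \<in> C) \<or> (f \<in> D \<and> g \<in> D)"
    using chain[of C D] by blast
  then have "(\<lambda>\<omega>. f \<omega> + g \<omega>) \<in> C \<or> (\<lambda>\<omega>. f \<omega> + g \<omega>) \<in> D"
    using pos_cone_add[OF assms(2)] CD by blast
  then show "(\<lambda>\<omega>. f \<omega> + g \<omega>) \<in> \<Union>\<C>"
    using CD by blast
next
  fix f and c :: real assume "f \<in> \<Union>\<C>" "0 \<le> c"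
  then show "(\<lambda>\<omega>. c * f \<omega>) \<in> \<Union>\<C>"
    using pos_cone_cmult[OF assms(2)] by blast
next
  fix f assume "f \<in> B_space \<Omega> A" "\<forall>\<omega>\<in>\<Omega>. 0 \<le> f \<omega>"
  moreover obtain C where "C \<in> \<C>"
    using assms(1) by blast
  ultimately show "f \<in> \<Union>\<C>"
    using pos_cone_nonneg[OF assms(2)] by blast
qed

context algebra
begin

lemma pos_cone_adjoin:
  assumes C: "pos_cone \<Omega> M C" and f: "f \<in> B_space \<Omega> M"
  defines "D \<equiv> {h. \<exists>g\<in>C. \<exists>a\<ge>0. h = (\<lambda>\<omega>. g \<omega> + a * f \<omega>)}"
  shows "pos_cone \<Omega> M D" "C \<subseteq> D" "f \<in> D"
proof -
  have D_I: "(\<lambda>\<omega>. g \<omega> + a * f \<omega>) \<in> D" if "g \<in> C" "0 \<le> a" for g a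
    unfolding D_def using that by blast
  show sub: "C \<subseteq> D"
    using D_I[of _ 0] by auto
  have "(\<lambda>_. 0) \<in> C"
    by (rule pos_cone_nonneg[OF C B_space_const]) simp
  then show "f \<in> D"
    using D_I[of "\<lambda>_. 0" 1] by simp
  show "pos_cone \<Omega> M D"
    unfolding pos_cone_def
  proof (intro conjI ballI allI impI)
    show "D \<subseteq> B_space \<Omega> M"
      unfolding D_def using B_space_add[OF pos_cone_sub[OF C] B_space_cmult[OF f]] by blast
  next
    fix h k assume "h \<in> D" "k \<in> D"
    then obtain g a g' a' where ga: "g \<in> C" "0 \<le> a" "h = (\<lambda>\<omega>. g \<omega> + a * f \<omega>)"
      "g' \<in> C" "0 \<le> a'" "k = (\<lambda>\<omega>. g' \<omega> + a' * f \<omega>)"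
      unfolding D_def by blast
    have "(\<lambda>\<omega>. h \<omega> + k \<omega>) = (\<lambda>\<omega>. (g \<omega> + g' \<omega>) + (a + a') * f \<omega>)"
      using ga by (simp add: algebra_simps)
    then show "(\<lambda>\<omega>. h \<omega> + k \<omega>) \<in> D"
      using D_I[OF pos_cone_add[OF C ga(1,4)] add_nonneg_nonneg[OF ga(2,5)]] by simp
  next
    fix h and c :: real assume "h \<in> D" "0 \<le> c"
    then obtain g a where ga: "g \<in> C" "0 \<le> a" "h = (\<lambda>\<omega>. g \<omega> + a * f \<omega>)"
      unfolding D_def by blast
    have "(\<lambda>\<omega>. c * h \<omega>) = (\<lambda>\<omega>. c * g \<omega> + (c * a) * f \<omega>)"
      using ga by (simp add: algebra_simps)
    then show "(\<lambda>\<omega>. c * h \<omega>) \<in> D"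
      using D_I[OF pos_cone_cmult[OF C ga(1) \<open>0 \<le> c\<close>] mult_nonneg_nonneg[OF \<open>0 \<le> c\<close> ga(2)]] by simp
  next
    fix h assume "h \<in> B_space \<Omega> M" "\<forall>\<omega>\<in>\<Omega>. 0 \<le> h \<omega>"
    then show "h \<in> D"
      using pos_cone_nonneg[OF C] sub by blast
  qed
qed

text \<open>Zorn's lemma gives a maximal cone omitting \<open>-1\<close>. If it contained neither
  \<open>f\<close> nor its negative, adjoining either would produce \<open>-1\<close>, and
  eliminating \<open>f\<close> from the two representations would put \<open>-1\<close> into the
  cone itself.\<close>

lemma pos_cone_extend_total:
  assumes C: "pos_cone \<Omega> M C" "(\<lambda>_. - 1) \<notin> C"
  obtains D where "pos_cone \<Omega> M D" "C \<subseteq> D" "(\<lambda>_. - 1) \<notin> D"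
    "\<And>f. f \<in> B_space \<Omega> M \<Longrightarrow> f \<in> D \<or> (\<lambda>\<omega>. - f \<omega>) \<in> D"
proof -
  define \<A> where "\<A> = {D. pos_cone \<Omega> M D \<and> C \<subseteq> D \<and> (\<lambda>_. - 1) \<notin> D}"
  have "\<exists>D\<in>\<A>. \<forall>X\<in>\<A>. D \<subseteq> X \<longrightarrow> X = D"
  proof (rule subset_Zorn_nonempty)
    show "\<A> \<noteq> {}"
      using C unfolding \<A>_def by blast
    fix \<C> assume \<C>: "\<C> \<noteq> {}" "subset.chain \<A> \<C>"
    then have sub: "\<C> \<subseteq> \<A>" and ch: "\<And>C D. C \<in> \<C> \<Longrightarrow> D \<in> \<C> \<Longrightarrow> C \<subseteq> D \<or> D \<subseteq> C"
      by (auto simp: subset_chain_def)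
    have "pos_cone \<Omega> M (\<Union>\<C>)"
      using sub by (intro pos_cone_Union_chain[OF \<C>(1) _ ch]) (auto simp: \<A>_def)
    then show "\<Union>\<C> \<in> \<A>"
      using sub \<C>(1) unfolding \<A>_def by blast
  qed
  then obtain D where DA: "D \<in> \<A>" and max: "\<And>X. X \<in> \<A> \<Longrightarrow> D \<subseteq> X \<Longrightarrow> X = D"
    by blast
  have D: "pos_cone \<Omega> M D" "C \<subseteq> D" "(\<lambda>_. - 1) \<notin> D"
    using DA by (auto simp: \<A>_def)
  have adjoin: "\<exists>g\<in>D. \<exists>a\<ge>0. \<forall>\<omega>. - 1 = g \<omega> + a * f \<omega>" if f: "f \<in> B_space \<Omega> M" "f \<notin> D" for f
  proof -
    let ?D = "{h. \<exists>g\<in>D. \<exists>a\<ge>0. h = (\<lambda>\<omega>. g \<omega> + a * f \<omega>)}"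
    note adj = pos_cone_adjoin[OF D(1) f(1)]
    have "?D \<notin> \<A>"
      using max[of ?D] adj f(2) by blast
    then have "(\<lambda>_. - 1) \<in> ?D"
      using adj(1,2) D(2) unfolding \<A>_def by blast
    then show ?thesis
      by (auto simp: fun_eq_iff)
  qed
  have "f \<in> D \<or> (\<lambda>\<omega>. - f \<omega>) \<in> D" if f: "f \<in> B_space \<Omega> M" for f
  proof (rule ccontr)
    assume neg: "\<not> (f \<in> D \<or> (\<lambda>\<omega>. - f \<omega>) \<in> D)"
    obtain g a where g: "g \<in> D" "0 \<le> a" "\<And>\<omega>. - 1 = g \<omega> + a * f \<omega>"
      using adjoin[OF f] neg by blast
    have "(\<lambda>\<omega>. - f \<omega>) \<in> B_space \<Omega> M"
      using B_space_cmult[OF f, of "- 1"] by simp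
    then obtain k b where k: "k \<in> D" "0 \<le> b" "\<And>\<omega>. - 1 = k \<omega> + b * - f \<omega>"
      using adjoin[of "\<lambda>\<omega>. - f \<omega>"] neg by blast
    have "a \<noteq> 0"
    proof
      assume "a = 0"
      then have "g = (\<lambda>_. - 1)"
        using g(3) by (simp add: fun_eq_iff)
      with g(1) D(3) show False
        by simp
    qed
    then have ab: "0 < a + b"
      using g(2) k(2) by simp
    \<comment> \<open>The weights \<open>b\<close> and \<open>a\<close> cancel the terms in
      \<open>f\<close>, leaving \<open>- (a + b)\<close>.\<close>
    have "(\<lambda>\<omega>. (1 / (a + b)) * (b * g \<omega> + a * k \<omega>)) \<in> D"
      using g k ab by (intro pos_cone_cmult[OF D(1)] pos_cone_add[OF D(1)]) auto
    moreover have "(1 / (a + b)) * (b * g \<omega> + a * k \<omega>) = - 1" for \<omega>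
    proof -
      have "g \<omega> = - 1 - a * f \<omega>" "k \<omega> = - 1 + b * f \<omega>"
        using g(3)[of \<omega>] k(3)[of \<omega>] by auto
      then have "b * g \<omega> + a * k \<omega> = b * (- 1 - a * f \<omega>) + a * (- 1 + b * f \<omega>)"
        by (simp only:)
      also have "\<dots> = - (a + b)"
        by (simp add: algebra_simps)
      finally have "b * g \<omega> + a * k \<omega> = - (a + b)" .
      then show ?thesis
        using ab by (simp add: divide_eq_eq)
    qed
    ultimately show False
      using D(3) by simp
  qed
  with D that show ?thesis
    by blast
qed

text \<open>A total cone determines a mean by cutting the constants: \<open>L f\<close> is the supremum of the
  \<open>r\<close> for which \<open>f - r\<close> lies in the cone.\<close>
lemma mean_of_pos_cone:
  assumes C: "pos_cone \<Omega> M C" "(\<lambda>_. - 1) \<notin> C"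
  obtains L where "mean \<Omega> M L" "\<And>f. f \<in> C \<Longrightarrow> 0 \<le> L f"
proof -
  obtain D where D: "pos_cone \<Omega> M D" "C \<subseteq> D" "(\<lambda>_. - 1) \<notin> D"
    and total: "\<And>f. f \<in> B_space \<Omega> M \<Longrightarrow> f \<in> D \<or> (\<lambda>\<omega>. - f \<omega>) \<in> D"
    using pos_cone_extend_total[OF C] by blast
  define L where "L f = Sup {r. (\<lambda>\<omega>. f \<omega> - r) \<in> D}" for f
  have B_shift: "(\<lambda>\<omega>. f \<omega> - r) \<in> B_space \<Omega> M" "(\<lambda>\<omega>. r - f \<omega>) \<in> B_space \<Omega> M"
    if "f \<in> B_space \<Omega> M" for f r
    by (intro B_space_diff B_space_const that)+
  have neg_const: "(\<lambda>_. c) \<notin> D" if "c < 0" for c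
  proof
    assume "(\<lambda>_. c) \<in> D"
    from pos_cone_cmult[OF D(1) this, of "- 1 / c"] that D(3) show False
      by (simp add: divide_nonpos_neg)
  qed
  \<comment> \<open>Otherwise the sum of the two members would be the negative constant
    \<open>q - r\<close>. This makes the supremum finite and keeps lower cuts below upper
    cuts.\<close>
  have sandwich: "r \<le> q" if "(\<lambda>\<omega>. f \<omega> - r) \<in> D" "(\<lambda>\<omega>. q - f \<omega>) \<in> D" for f r q
    using pos_cone_add[OF D(1) that] neg_const[of "q - r"] by (cases "r \<le> q") simp_all
  have ex: "\<exists>r q. (\<lambda>\<omega>. f \<omega> - r) \<in> D \<and> (\<lambda>\<omega>. q - f \<omega>) \<in> D" if f: "f \<in> B_space \<Omega> M" for f
  proof -
    obtain b where b: "\<And>\<omega>. \<omega> \<in> \<Omega> \<Longrightarrow> \<bar>f \<omega>\<bar> \<le> b"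
      using B_space_bounded[OF f] by blast
    have "(\<lambda>\<omega>. f \<omega> - (- b)) \<in> D" "(\<lambda>\<omega>. b - f \<omega>) \<in> D"
      using b by (intro pos_cone_nonneg[OF D(1) B_shift(1)[OF f]] pos_cone_nonneg[OF D(1) B_shift(2)[OF f]];
          fastforce simp: abs_le_iff)+
    then show ?thesis
      by blast
  qed
  have bdd: "bdd_above {r. (\<lambda>\<omega>. f \<omega> - r) \<in> D}" if f: "f \<in> B_space \<Omega> M" for f
    using ex[OF f] sandwich[of f] by (auto simp: bdd_above_def)
  have lower: "r \<le> L f" if "f \<in> B_space \<Omega> M" "(\<lambda>\<omega>. f \<omega> - r) \<in> D" for f r
    unfolding L_def by (rule cSup_upper) (use that bdd in auto)
  have upper: "L f \<le> q" if "f \<in> B_space \<Omega> M" "(\<lambda>\<omega>. q - f \<omega>) \<in> D" for f q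
    unfolding L_def by (rule cSup_least) (use that ex[of f] sandwich[of f] in auto)
  \<comment> \<open>Totality enters here: \<open>f - (L f + e)\<close> exceeds the supremum and is
    not in \<open>D\<close>, so its negative is.\<close>
  have above: "(\<lambda>\<omega>. (L f + e) - f \<omega>) \<in> D" if f: "f \<in> B_space \<Omega> M" and "0 < e" for f e
  proof -
    have "(\<lambda>\<omega>. f \<omega> - (L f + e)) \<notin> D"
      using lower[OF f] \<open>0 < e\<close> by fastforce
    then show ?thesis
      using total[OF B_shift(1)[OF f]] by fastforce
  qed
  have below: "(\<lambda>\<omega>. f \<omega> - (L f - e)) \<in> D" if f: "f \<in> B_space \<Omega> M" and "0 < e" for f e
  proof -
    have "(\<lambda>\<omega>. (L f - e) - f \<omega>) \<notin> D"
      using upper[OF f] \<open>0 < e\<close> by fastforce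
    then show ?thesis
      using total[OF B_shift(2)[OF f]] by fastforce
  qed
  \<comment> \<open>The cone is not known to be closed and the supremum need not be attained, so
    identities for \<open>L\<close> are checked with slack \<open>e\<close> on both sides.\<close>
  have L_eqI: "L f = x"
    if f: "f \<in> B_space \<Omega> M" and lo: "\<And>e. 0 < e \<Longrightarrow> (\<lambda>\<omega>. f \<omega> - (x - e)) \<in> D"
      and up: "\<And>e. 0 < e \<Longrightarrow> (\<lambda>\<omega>. (x + e) - f \<omega>) \<in> D" for f x
  proof (rule antisym)
    show "L f \<le> x"
      by (rule field_le_epsilon) (use upper[OF f up] in auto)
    have "x \<le> L f + e" if "0 < e" for e
      using lower[OF f lo[OF that]] by simp
    then show "x \<le> L f"
      by (rule field_le_epsilon)
  qed
  have nonneg: "0 \<le> L f" if "f \<in> D" for f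
    using lower[OF pos_cone_sub[OF D(1) that], of 0] that by simp
  have add: "L (\<lambda>\<omega>. f \<omega> + g \<omega>) = L f + L g" if f: "f \<in> B_space \<Omega> M" and g: "g \<in> B_space \<Omega> M" for f g
  proof (rule L_eqI[OF B_space_add[OF f g]])
    fix e :: real assume "0 < e"
    then have e: "0 < e / 2" by simp
    show "(\<lambda>\<omega>. f \<omega> + g \<omega> - (L f + L g - e)) \<in> D"
      using pos_cone_add[OF D(1) below[OF f e] below[OF g e]] by (simp add: algebra_simps)
    show "(\<lambda>\<omega>. (L f + L g + e) - (f \<omega> + g \<omega>)) \<in> D"
      using pos_cone_add[OF D(1) above[OF f e] above[OF g e]] by (simp add: algebra_simps)
  qed
  have cmult_pos: "L (\<lambda>\<omega>. c * f \<omega>) = c * L f" if f: "f \<in> B_space \<Omega> M" and c: "0 < c" for c f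
  proof (rule L_eqI[OF B_space_cmult[OF f]])
    fix e :: real assume "0 < e"
    then have e: "0 < e / c" using c by simp
    show "(\<lambda>\<omega>. c * f \<omega> - (c * L f - e)) \<in> D"
      using pos_cone_cmult[OF D(1) below[OF f e], of c] c by (simp add: algebra_simps)
    show "(\<lambda>\<omega>. (c * L f + e) - c * f \<omega>) \<in> D"
      using pos_cone_cmult[OF D(1) above[OF f e], of c] c by (simp add: algebra_simps)
  qed
  have const: "L (\<lambda>_. c) = c" for c
    by (rule L_eqI[OF B_space_const]; rule pos_cone_nonneg[OF D(1) B_space_const]) simp_all
  have cmult: "L (\<lambda>\<omega>. c * f \<omega>) = c * L f" if f: "f \<in> B_space \<Omega> M" for c f
  proof (cases "c > 0")
    case False
    show ?thesis
    proof (cases "c = 0")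
      case True
      then show ?thesis
        using const[of 0] by simp
    next
      case c: False
      with False have "0 < - c" by simp
      \<comment> \<open>The summands add up to zero and the second has a positive factor, so
        additivity settles negative \<open>c\<close>.\<close>
      have "L (\<lambda>\<omega>. c * f \<omega> + (- c) * f \<omega>) = L (\<lambda>\<omega>. c * f \<omega>) + L (\<lambda>\<omega>. (- c) * f \<omega>)"
        by (rule add; rule B_space_cmult[OF f])
      then show ?thesis
        using cmult_pos[OF f \<open>0 < - c\<close>] const[of 0] by simp
    qed
  qed (use cmult_pos[OF f] in simp)
  have mono: "L f \<le> L g"
    if f: "f \<in> B_space \<Omega> M" and g: "g \<in> B_space \<Omega> M" and le: "\<forall>\<omega>\<in>\<Omega>. f \<omega> \<le> g \<omega>" for f g
  proof -
    have "(\<lambda>\<omega>. g \<omega> - f \<omega>) \<in> D"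
      using le by (intro pos_cone_nonneg[OF D(1) B_space_diff[OF g f]]) auto
    from nonneg[OF this] add[OF f B_space_diff[OF g f]] show ?thesis
      by simp
  qed
  have "mean \<Omega> M L"
    unfolding mean_def using add cmult mono const by simp
  moreover have "0 \<le> L f" if "f \<in> C" for f
    using nonneg D(2) that by blast
  ultimately show ?thesis
    using that by blast
qed

end

section \<open>Finite-dimensional separation and the priors\<close>

text \<open>The separating vector points from \<open>p\<close> to an almost nearest point of \<open>C\<close>.\<close>
lemma finite_coordinate_separation:
  fixes p :: "'k \<Rightarrow> real"
  assumes "finite F" "C \<noteq> {}" "0 < e"
    and mix: "\<And>x y s. x \<in> C \<Longrightarrow> y \<in> X \<Longrightarrow> 0 \<le> s \<Longrightarrow> s \<le> 1 \<Longrightarrow> (\<lambda>k. (1 - s) * x k + s * y k) \<in> C"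
    and bnd: "\<And>x k. x \<in> C \<union> X \<Longrightarrow> k \<in> F \<Longrightarrow> \<bar>x k\<bar> \<le> b k"
    and far: "\<And>x. x \<in> C \<Longrightarrow> \<exists>k\<in>F. e \<le> \<bar>p k - x k\<bar>"
  obtains c d where "\<And>y. y \<in> X \<Longrightarrow> d \<le> (\<Sum>k\<in>F. c k * y k)" "(\<Sum>k\<in>F. c k * p k) < d"
proof -
  define N where "N x = (\<Sum>k\<in>F. (x k - p k)\<^sup>2)" for x
  \<comment> \<open>\<open>R\<close> bounds the squared distance between a point of \<open>C\<close>
    and one of \<open>X\<close>. The step length \<open>s\<close> satisfies
    \<open>s * R \<le> e\<^sup>2\<close>, so the quadratic term of the expansion below is at most
    \<open>s * e\<^sup>2\<close>.\<close>
  define R where "R = (\<Sum>k\<in>F. (2 * b k)\<^sup>2)"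
  define s where "s = e\<^sup>2 / (R + e\<^sup>2)"
  have R: "0 \<le> R"
    unfolding R_def by (intro sum_nonneg) auto
  have e2: "0 < e\<^sup>2"
    using \<open>0 < e\<close> by simp
  have Re: "0 < R + e\<^sup>2"
    using R e2 by (rule add_nonneg_pos)
  have s: "0 < s" "s \<le> 1" "s * R \<le> e\<^sup>2"
    using R e2 Re by (simp_all add: s_def pos_divide_le_eq mult_left_mono)
  have N_far: "e\<^sup>2 \<le> N x" if x: "x \<in> C" for x
  proof -
    obtain k where k: "k \<in> F" "e \<le> \<bar>p k - x k\<bar>"
      using far[OF x] by blast
    have "e\<^sup>2 \<le> \<bar>p k - x k\<bar>\<^sup>2"
      using k(2) \<open>0 < e\<close> by (intro power_mono) auto
    also have "\<dots> = (x k - p k)\<^sup>2"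
      by (simp add: power2_commute)
    also have "\<dots> \<le> N x"
      unfolding N_def using \<open>finite F\<close> k(1) by (intro member_le_sum) auto
    finally show ?thesis .
  qed
  define D where "D = Inf (N ` C)"
  have D_le: "D \<le> N x" if "x \<in> C" for x
    unfolding D_def using that N_far by (intro cInf_lower) (auto simp: bdd_below_def)
  have "e\<^sup>2 \<le> D"
    unfolding D_def using \<open>C \<noteq> {}\<close> N_far by (intro cInf_greatest) auto
  \<comment> \<open>The infimum need not be attained. The slack is proportional to \<open>s\<close>
    so that it survives the later division by \<open>s\<close>.\<close>
  have "Inf (N ` C) < D + s * e\<^sup>2 / 2"
    unfolding D_def using s(1) e2 by simp
  then obtain x where x: "x \<in> C" "N x < D + s * e\<^sup>2 / 2"
    using cInf_lessD[of "N ` C"] \<open>C \<noteq> {}\<close> by blast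
  define c where "c k = x k - p k" for k
  have "(\<Sum>k\<in>F. c k * p k) + e\<^sup>2 / 4 \<le> (\<Sum>k\<in>F. c k * y k)" if y: "y \<in> X" for y
  proof -
    define u where "u = (\<Sum>k\<in>F. c k * (y k - x k))"
    define v where "v = (\<Sum>k\<in>F. (y k - x k)\<^sup>2)"
    have "v \<le> R"
      unfolding v_def R_def
    proof (rule sum_mono)
      fix k assume k: "k \<in> F"
      have "\<bar>y k - x k\<bar> \<le> 2 * b k"
        using bnd[of y k] bnd[of x k] x y k by auto
      then show "(y k - x k)\<^sup>2 \<le> (2 * b k)\<^sup>2"
        using power_mono[of "\<bar>y k - x k\<bar>" "2 * b k" 2] by simp
    qed
    \<comment> \<open>Squared distance from \<open>p\<close> after a step of length \<open>s\<close>
      from \<open>x\<close> towards \<open>y\<close>. It cannot fall below the infimum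
      \<open>D\<close>, which forces \<open>u\<close> to be at least
      \<open>- 3 * e\<^sup>2 / 4\<close>.\<close>
    have "N (\<lambda>k. (1 - s) * x k + s * y k) =
        (\<Sum>k\<in>F. (x k - p k)\<^sup>2 + (2 * s) * (c k * (y k - x k)) + s\<^sup>2 * (y k - x k)\<^sup>2)"
      unfolding N_def c_def by (intro sum.cong refl) (simp add: power2_eq_square algebra_simps)
    also have "\<dots> = N x + (2 * s) * u + s\<^sup>2 * v"
      unfolding N_def u_def v_def by (simp only: sum.distrib sum_distrib_left)
    finally have "D \<le> N x + (2 * s) * u + s\<^sup>2 * v"
      using D_le[OF mix[OF x(1) y, of s]] s(1,2) by simp
    also have "\<dots> \<le> N x + (2 * s) * u + s * e\<^sup>2"
    proof -
      have "s\<^sup>2 * v \<le> s * (s * R)"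
        using \<open>v \<le> R\<close> s(1) by (simp add: power2_eq_square mult_left_mono)
      also have "\<dots> \<le> s * e\<^sup>2"
        using s by (intro mult_left_mono) auto
      finally show ?thesis
        by simp
    qed
    finally have "D \<le> D + s * e\<^sup>2 / 2 + (2 * s) * u + s * e\<^sup>2"
      using x(2) by linarith
    then have "0 \<le> s * (3 * e\<^sup>2 / 2 + 2 * u)"
      by (simp add: algebra_simps)
    then have "- 3 * e\<^sup>2 / 4 \<le> u"
      using s(1) by (simp add: zero_le_mult_iff)
    \<comment> \<open>As \<open>N x\<close> is at least \<open>e\<^sup>2\<close>, a margin of
      \<open>e\<^sup>2 / 4\<close> over the value at \<open>p\<close> remains.\<close>
    moreover have "(\<Sum>k\<in>F. c k * y k) = (\<Sum>k\<in>F. c k * p k) + N x + u"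
      unfolding N_def u_def sum.distrib[symmetric] c_def
      by (intro sum.cong refl) (simp add: power2_eq_square algebra_simps)
    ultimately show ?thesis
      using N_far[OF x(1)] by simp
  qed
  moreover have "(\<Sum>k\<in>F. c k * p k) < (\<Sum>k\<in>F. c k * p k) + e\<^sup>2 / 4"
    using e2 by simp
  ultimately show ?thesis
    using that by blast
qed

text \<open>Segments towards a single type are what the separation argument uses. The new type is
  appended at index \<open>n\<close> with weight \<open>s\<close>, and the old weights are scaled by
  \<open>1 - s\<close>.\<close>

lemma conv_types_mix:
  assumes "P \<in> conv_types \<Omega> t i" "\<omega> \<in> \<Omega>" "0 \<le> s" "s \<le> 1"
  shows "(\<lambda>E. (1 - s) * P E + s * t i \<omega> E) \<in> conv_types \<Omega> t i"
proof -
  obtain n w l where P: "\<forall>k<n. w k \<in> \<Omega> \<and> 0 \<le> l k" "(\<Sum>k<n. l k) = 1"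
    "P = (\<lambda>E. \<Sum>k<(n::nat). l k * t i (w k) E)"
    using assms(1) unfolding conv_types_def by blast
  define l' where "l' k = (if k < n then (1 - s) * l k else s)" for k
  define w' where "w' k = (if k < n then w k else \<omega>)" for k
  have "(\<Sum>k<Suc n. l' k) = 1"
    using P(2) by (simp add: l'_def flip: sum_distrib_left)
  moreover have "\<forall>k<Suc n. w' k \<in> \<Omega> \<and> 0 \<le> l' k"
    using P(1) assms by (auto simp: l'_def w'_def)
  moreover have "(\<lambda>E. (1 - s) * P E + s * t i \<omega> E) = (\<lambda>E. \<Sum>k<Suc n. l' k * t i (w' k) E)"
    unfolding P(3) by (simp add: l'_def w'_def sum_distrib_left mult.assoc)
  ultimately show ?thesis
    unfolding conv_types_def by blast
qed

lemma conv_types_vertex: "\<omega> \<in> \<Omega> \<Longrightarrow> t i \<omega> \<in> conv_types \<Omega> t i"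
  unfolding conv_types_def
  by (intro CollectI exI[of _ "1::nat"] exI[of _ "\<lambda>_. \<omega>"] exI[of _ "\<lambda>_. 1"]) simp

context algebra
begin

lemma pba_cong:
  assumes "pba \<Omega> M P" "\<And>E. E \<in> M \<Longrightarrow> Q E = P E"
  shows "pba \<Omega> M Q"
  using assms Un by (simp add: pba_def fin_add_def)

text \<open>The weighted sum of the integrals is a mean whose indicator values are the weighted
  probabilities, so it is the integral against their combination.\<close>

lemma pba_convex_combination:
  assumes "\<And>k. k \<in> J \<Longrightarrow> pba \<Omega> M (p k)" "\<And>k. k \<in> J \<Longrightarrow> 0 \<le> l k" "(\<Sum>k\<in>J. l k) = (1::real)"
  shows "pba \<Omega> M (\<lambda>E. \<Sum>k\<in>J. l k * p k E)"
    and "f \<in> B_space \<Omega> M \<Longrightarrow>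
      fa_integral \<Omega> M (\<lambda>E. \<Sum>k\<in>J. l k * p k E) f = (\<Sum>k\<in>J. l k * fa_integral \<Omega> M (p k) f)"
proof -
  have L: "mean \<Omega> M (\<lambda>f. \<Sum>k\<in>J. l k * fa_integral \<Omega> M (p k) f)"
    using assms by (intro mean_convex_combination mean_fa_integral)
  have ind: "(\<Sum>k\<in>J. l k * fa_integral \<Omega> M (p k) (indicator E)) = (\<Sum>k\<in>J. l k * p k E)" if "E \<in> M" for E
    using assms(1) that by (intro sum.cong refl) (simp add: fa_integral_indicator)
  show pba: "pba \<Omega> M (\<lambda>E. \<Sum>k\<in>J. l k * p k E)"
    by (rule pba_cong[OF mean_imp_pba[OF L]]) (simp add: ind)
  show "fa_integral \<Omega> M (\<lambda>E. \<Sum>k\<in>J. l k * p k E) f = (\<Sum>k\<in>J. l k * fa_integral \<Omega> M (p k) f)"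
    if "f \<in> B_space \<Omega> M"
    by (rule mean_eq_fa_integral[OF L pba ind that])
qed

lemma conv_types_pba:
  assumes "\<And>\<omega>. \<omega> \<in> \<Omega> \<Longrightarrow> pba \<Omega> M (t i \<omega>)" "P \<in> conv_types \<Omega> t i"
  shows "pba \<Omega> M P"
  using assms(2) unfolding conv_types_def
  by (auto intro!: pba_convex_combination(1) assms(1))

lemma fa_integral_mix:
  assumes "pba \<Omega> M P" "pba \<Omega> M Q" "0 \<le> s" "s \<le> 1" "f \<in> B_space \<Omega> M"
  shows "fa_integral \<Omega> M (\<lambda>E. (1 - s) * P E + s * Q E) f =
    (1 - s) * fa_integral \<Omega> M P f + s * fa_integral \<Omega> M Q f"
  using pba_convex_combination(2)[of "UNIV :: bool set" "\<lambda>k. if k then Q else P"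
      "\<lambda>k. if k then s else 1 - s" f] assms
  by (simp add: UNIV_bool)

text \<open>A bipolar argument. Outside the weak* closure, finitely many test functions would
  separate \<open>L\<close> from all types; the separating combination minus its threshold then has
  nonnegative posterior expectation everywhere but negative mean, against
  \<open>pos\<close>.\<close>

lemma mean_in_Pi_i:
  assumes t: "\<And>\<omega>. \<omega> \<in> \<Omega> \<Longrightarrow> pba \<Omega> M (t i \<omega>)" and "\<Omega> \<noteq> {}" and L: "mean \<Omega> M L"
    and pos: "\<And>h. h \<in> B_space \<Omega> M \<Longrightarrow> (\<And>\<omega>. \<omega> \<in> \<Omega> \<Longrightarrow> 0 \<le> fa_integral \<Omega> M (t i \<omega>) h) \<Longrightarrow> 0 \<le> L h"
  shows "(\<lambda>E. L (indicator E)) \<in> Pi_i \<Omega> M t i"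
proof -
  let ?P = "\<lambda>E. L (indicator E)"
  have P: "pba \<Omega> M ?P"
    by (rule mean_imp_pba[OF L])
  have PL: "fa_integral \<Omega> M ?P f = L f" if "f \<in> B_space \<Omega> M" for f
    by (rule mean_eq_fa_integral[OF L P _ that]) simp
  have "\<exists>\<nu>\<in>conv_types \<Omega> t i. \<forall>f\<in>Fs. \<bar>fa_integral \<Omega> M ?P f - fa_integral \<Omega> M \<nu> f\<bar> < e"
    if Fs: "finite Fs" "Fs \<subseteq> B_space \<Omega> M" and "0 < e" for Fs e
  proof (rule ccontr)
    assume neg: "\<not> ?thesis"
    \<comment> \<open>Coordinates are indexed by all functions, while integrals are known to be
      linear only on B. Prescribing values on \<open>B_space\<close> alone lets closure under mixing
      follow from that linearity.\<close>
    define C where "C = {x. \<exists>\<nu>\<in>conv_types \<Omega> t i. \<forall>f\<in>B_space \<Omega> M. x f = fa_integral \<Omega> M \<nu> f}"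
    define X where "X = {x. \<exists>\<omega>\<in>\<Omega>. \<forall>f\<in>B_space \<Omega> M. x f = fa_integral \<Omega> M (t i \<omega>) f}"
    have "\<exists>b. \<forall>f\<in>Fs. \<forall>\<omega>\<in>\<Omega>. \<bar>f \<omega>\<bar> \<le> b f"
    proof (rule bchoice, rule ballI)
      fix f assume "f \<in> Fs"
      then have "f \<in> B_space \<Omega> M"
        using Fs(2) by blast
      then obtain b where "\<And>\<omega>. \<omega> \<in> \<Omega> \<Longrightarrow> \<bar>f \<omega>\<bar> \<le> b"
        using B_space_bounded by blast
      then show "\<exists>b. \<forall>\<omega>\<in>\<Omega>. \<bar>f \<omega>\<bar> \<le> b"
        by (intro exI[of _ b]) simp
    qed
    then obtain b where b: "\<And>f \<omega>. f \<in> Fs \<Longrightarrow> \<omega> \<in> \<Omega> \<Longrightarrow> \<bar>f \<omega>\<bar> \<le> b f"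
      by blast
    obtain c d where cd: "\<And>y. y \<in> X \<Longrightarrow> d \<le> (\<Sum>f\<in>Fs. c f * y f)" "(\<Sum>f\<in>Fs. c f * L f) < d"
    proof (rule finite_coordinate_separation[OF Fs(1) _ \<open>0 < e\<close>, of C X b L])
      show "C \<noteq> {}"
        using \<open>\<Omega> \<noteq> {}\<close> conv_types_vertex[of _ \<Omega> t i] unfolding C_def by blast
    next
      fix x y and s :: real assume "x \<in> C" "y \<in> X" and s: "0 \<le> s" "s \<le> 1"
      then obtain \<nu> \<omega> where x: "\<nu> \<in> conv_types \<Omega> t i" "\<And>f. f \<in> B_space \<Omega> M \<Longrightarrow> x f = fa_integral \<Omega> M \<nu> f"
        and y: "\<omega> \<in> \<Omega>" "\<And>f. f \<in> B_space \<Omega> M \<Longrightarrow> y f = fa_integral \<Omega> M (t i \<omega>) f"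
        unfolding C_def X_def by blast
      have \<nu>: "pba \<Omega> M \<nu>"
        using conv_types_pba[of t i, OF t x(1)] by simp
      show "(\<lambda>k. (1 - s) * x k + s * y k) \<in> C"
        unfolding C_def
        by (intro CollectI bexI[OF _ conv_types_mix[OF x(1) y(1) s]] ballI)
          (simp add: x(2) y(2) fa_integral_mix[OF \<nu> t[OF y(1)] s])
    next
      fix x f assume x: "x \<in> C \<union> X" and f: "f \<in> Fs"
      then have fB: "f \<in> B_space \<Omega> M"
        using Fs(2) by blast
      obtain \<nu> where \<nu>: "pba \<Omega> M \<nu>" "x f = fa_integral \<Omega> M \<nu> f"
        using x fB conv_types_pba[of t i, OF t] t unfolding C_def X_def by blast
      then show "\<bar>x f\<bar> \<le> b f"
        using mean_abs_le[OF mean_fa_integral[OF \<nu>(1)] fB] b[OF f] by simp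
    next
      fix x assume "x \<in> C"
      then obtain \<nu> where \<nu>: "\<nu> \<in> conv_types \<Omega> t i" "\<And>f. f \<in> B_space \<Omega> M \<Longrightarrow> x f = fa_integral \<Omega> M \<nu> f"
        unfolding C_def by blast
      obtain f where "f \<in> Fs" "e \<le> \<bar>fa_integral \<Omega> M ?P f - fa_integral \<Omega> M \<nu> f\<bar>"
        using neg \<nu>(1) by (auto simp: not_less)
      then show "\<exists>k\<in>Fs. e \<le> \<bar>L k - x k\<bar>"
        using Fs(2) \<nu>(2) PL by (metis subsetD)
    qed blast
    define h where "h = (\<lambda>\<omega>. (\<Sum>f\<in>Fs. c f * f \<omega>) - d)"
    have sumB: "(\<lambda>\<omega>. \<Sum>f\<in>Fs. c f * f \<omega>) \<in> B_space \<Omega> M"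
      using Fs(2) by (intro B_space_sum B_space_cmult) auto
    have h: "h \<in> B_space \<Omega> M"
      unfolding h_def by (intro B_space_diff sumB B_space_const)
    have K_h: "K h = (\<Sum>f\<in>Fs. c f * K f) - d" if K: "mean \<Omega> M K" for K
    proof -
      have "K h = K (\<lambda>\<omega>. \<Sum>f\<in>Fs. c f * f \<omega>) - d"
        unfolding h_def mean_diff[OF K sumB B_space_const] mean_const[OF K] ..
      also have "K (\<lambda>\<omega>. \<Sum>f\<in>Fs. c f * f \<omega>) = (\<Sum>f\<in>Fs. K (\<lambda>\<omega>. c f * f \<omega>))"
        using Fs(2) by (intro mean_sum[OF K] B_space_cmult) auto
      also have "\<dots> = (\<Sum>f\<in>Fs. c f * K f)"
        using Fs(2) by (intro sum.cong refl mean_cmult[OF K]) auto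
      finally show ?thesis .
    qed
    have "0 \<le> fa_integral \<Omega> M (t i \<omega>) h" if "\<omega> \<in> \<Omega>" for \<omega>
      using cd(1)[of "fa_integral \<Omega> M (t i \<omega>)"] that K_h[OF mean_fa_integral[OF t[OF that]]]
      unfolding X_def by auto
    then have "0 \<le> L h"
      by (rule pos[OF h])
    with K_h[OF L] cd(2) show False
      by simp
  qed
  then show ?thesis
    using pba_imp_ba[OF P] unfolding Pi_i_def weak_star_closure_def by blast
qed

end

section \<open>Posterior expectations\<close>

context algebra
begin

lemma fa_integral_null_set:
  assumes P: "pba \<Omega> M P" and E: "E \<in> M" "P E = 0" and f: "f \<in> B_space \<Omega> M"
  shows "fa_integral \<Omega> M P (\<lambda>\<omega>. f \<omega> * indicator E \<omega>) = 0"
proof -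
  note L = mean_fa_integral[OF P]
  have fE: "(\<lambda>\<omega>. f \<omega> * indicator E \<omega>) \<in> B_space \<Omega> M"
    by (rule B_space_mult_indicator[OF f E(1)])
  obtain b where b: "\<And>\<omega>. \<omega> \<in> \<Omega> \<Longrightarrow> \<bar>f \<omega>\<bar> \<le> b"
    using B_space_bounded[OF f] by blast
  have bound: "fa_integral \<Omega> M P (\<lambda>\<omega>. c * indicator E \<omega>) = 0" for c
    using mean_cmult[OF L B_space_indicator[OF E(1)]] fa_integral_indicator[OF P E(1)] E(2) by simp
  have "fa_integral \<Omega> M P (\<lambda>\<omega>. f \<omega> * indicator E \<omega>) \<le> fa_integral \<Omega> M P (\<lambda>\<omega>. b * indicator E \<omega>)"
    using b by (intro mean_mono[OF L fE] B_space_cmult B_space_indicator E(1))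
      (auto simp: indicator_def abs_le_iff)
  moreover have "fa_integral \<Omega> M P (\<lambda>\<omega>. (- b) * indicator E \<omega>) \<le> fa_integral \<Omega> M P (\<lambda>\<omega>. f \<omega> * indicator E \<omega>)"
  proof (rule mean_mono[OF L B_space_cmult[OF B_space_indicator[OF E(1)]] fE])
    show "(- b) * indicator E \<omega> \<le> f \<omega> * indicator E \<omega>" if "\<omega> \<in> \<Omega>" for \<omega>
      using abs_le_D2[OF b[OF that]] by (simp add: indicator_def)
  qed
  ultimately show ?thesis
    unfolding bound by simp
qed

lemma fa_integral_full_set:
  assumes P: "pba \<Omega> M P" and E: "E \<in> M" "P E = 1" and f: "f \<in> B_space \<Omega> M"
  shows "fa_integral \<Omega> M P (\<lambda>\<omega>. f \<omega> * indicator E \<omega>) = fa_integral \<Omega> M P f"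
proof -
  note L = mean_fa_integral[OF P]
  let ?c = "\<lambda>\<omega>. f \<omega> * indicator (\<Omega> - E) \<omega>"
  have B: "(\<lambda>\<omega>. f \<omega> * indicator E \<omega>) \<in> B_space \<Omega> M" "?c \<in> B_space \<Omega> M"
    using E(1) by (intro B_space_mult_indicator f; auto)+
  have "fa_integral \<Omega> M P f = fa_integral \<Omega> M P (\<lambda>\<omega>. f \<omega> * indicator E \<omega> + ?c \<omega>)"
    by (rule mean_cong[OF L f B_space_add[OF B]]) (auto simp: indicator_def)
  also have "\<dots> = fa_integral \<Omega> M P (\<lambda>\<omega>. f \<omega> * indicator E \<omega>) + fa_integral \<Omega> M P ?c"
    by (rule mean_add[OF L B])
  also have "fa_integral \<Omega> M P ?c = 0"
    using E pba_Diff[OF P E(1)] by (intro fa_integral_null_set[OF P _ _ f]) auto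
  finally show ?thesis
    by simp
qed

end

section \<open>The beliefs of a single player\<close>

locale belief = A: algebra \<Omega> A + M: algebra \<Omega> M
  for \<Omega> :: "'w set" and A M :: "'w set set" +
  fixes \<tau> :: "'w \<Rightarrow> 'w set \<Rightarrow> real"
  assumes M_sub: "M \<subseteq> A"
    and pba: "\<omega> \<in> \<Omega> \<Longrightarrow> pba \<Omega> A (\<tau> \<omega>)"
    and meas: "E \<in> A \<Longrightarrow> (\<lambda>\<omega>. \<tau> \<omega> E) \<in> B_space \<Omega> M"
    and certain: "E \<in> M \<Longrightarrow> \<omega> \<in> E \<Longrightarrow> \<tau> \<omega> E = 1"
begin

lemma belief_of_own_event:
  assumes "E \<in> M" "\<omega> \<in> \<Omega>"
  shows "\<tau> \<omega> E = indicator E \<omega>"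
proof (cases "\<omega> \<in> E")
  case False
  then have "\<tau> \<omega> (\<Omega> - E) = 1"
    using assms by (intro certain) auto
  then show ?thesis
    using A.pba_Diff[OF pba[OF assms(2)], of E] assms(1) M_sub False by auto
qed (use assms certain in auto)

text \<open>If \<open>\<tau> \<omega> E < 1\<close>, some event \<open>F\<close> of the player's own
  field contains all states where \<open>E\<close> is certain, hence \<open>E\<close>, but not
  \<open>\<omega>\<close>. The player knows at \<open>\<omega>\<close> that \<open>F\<close> fails,
  so \<open>F\<close> and with it \<open>E\<close> get probability 0.\<close>

lemma self_certain_zero_one:
  assumes E: "E \<in> A" "\<And>\<omega>. \<omega> \<in> E \<Longrightarrow> \<tau> \<omega> E = 1" and \<omega>: "\<omega> \<in> \<Omega>"
  shows "\<tau> \<omega> E = 0 \<or> \<tau> \<omega> E = 1"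
proof (cases "\<tau> \<omega> E < 1")
  case True
  obtain F where F: "F \<in> M" "\<And>\<omega>. \<omega> \<in> \<Omega> \<Longrightarrow> 1 \<le> \<tau> \<omega> E \<Longrightarrow> \<omega> \<in> F"
      "\<And>\<omega>'. \<omega>' \<in> F \<Longrightarrow> (\<tau> \<omega> E + 1) / 2 \<le> \<tau> \<omega>' E"
    \<comment> \<open>The midpoint threshold lies strictly above \<open>\<tau> \<omega> E\<close>,
      which keeps \<open>\<omega>\<close> out of \<open>F\<close>.\<close>
    using M.B_space_superlevel[OF meas[OF E(1)], of "(\<tau> \<omega> E + 1) / 2" 1] True by auto
  have "\<omega> \<notin> F"
    using F(3)[of \<omega>] True by (auto simp: field_simps)
  then have "\<tau> \<omega> F = 0"
    using belief_of_own_event[OF F(1) \<omega>] by simp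
  moreover have "E \<subseteq> F"
    using F(2) E A.sets_into_space by fastforce
  then have "\<tau> \<omega> E \<le> \<tau> \<omega> F"
    using A.pba_mono[OF pba[OF \<omega>] E(1)] F(1) M_sub by blast
  moreover have "0 \<le> \<tau> \<omega> E"
    using pba[OF \<omega>] E(1) by (simp add: pba_def)
  ultimately show ?thesis
    by simp
next
  case False
  moreover have "\<tau> \<omega> E \<le> \<tau> \<omega> \<Omega>"
    using A.pba_mono[OF pba[OF \<omega>] E(1) A.top] E(1) A.sets_into_space by blast
  ultimately show ?thesis
    using pba[OF \<omega>] by (simp add: pba_def)
qed

text \<open>Integration against \<open>\<tau> \<omega>\<close> and evaluation at
  \<open>\<omega>\<close> are both means on the player's own field and agree on its events.\<close>

lemma integral_of_own_function:
  assumes "h \<in> B_space \<Omega> M" "\<omega> \<in> \<Omega>"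
  shows "fa_integral \<Omega> A (\<tau> \<omega>) h = h \<omega>"
proof (rule M.mean_unique[OF mean_subfield[OF A.mean_fa_integral[OF pba] M_sub] mean_eval _ assms(1)])
  show "fa_integral \<Omega> A (\<tau> \<omega>) (indicator E) = indicator E \<omega>" if "E \<in> M" for E
    using that A.fa_integral_indicator[OF pba[OF assms(2)]] belief_of_own_event[OF that assms(2)] M_sub by auto
qed (rule assms(2))+

text \<open>For a simple function the posterior is a finite combination of maps
  \<open>\<lambda>\<omega>. \<tau> \<omega> E\<close>, covered by \<open>meas\<close>. The
  approximation error is uniform in \<open>\<omega>\<close>, so uniform limits give the
  rest.\<close>

lemma posterior_B_space:
  assumes f: "f \<in> B_space \<Omega> A"
  shows "(\<lambda>\<omega>. fa_integral \<Omega> A (\<tau> \<omega>) f) \<in> B_space \<Omega> M"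
proof (rule M.B_space_uniform_limit)
  fix e :: real assume "0 < e"
  then obtain s where s: "simple_fun \<Omega> A s" "\<And>\<omega>. \<omega> \<in> \<Omega> \<Longrightarrow> \<bar>f \<omega> - s \<omega>\<bar> \<le> e"
    using B_spaceE[OF f] by blast
  have "(\<lambda>\<omega>. simple_integral \<Omega> (\<tau> \<omega>) s) \<in> B_space \<Omega> M"
    unfolding simple_integral_def
    using s(1) by (intro M.B_space_sum M.B_space_cmult meas) (auto simp: simple_fun_def)
  moreover have "\<bar>fa_integral \<Omega> A (\<tau> \<omega>) f - simple_integral \<Omega> (\<tau> \<omega>) s\<bar> \<le> e" if "\<omega> \<in> \<Omega>" for \<omega>
    by (rule A.fa_integral_close_simple[OF pba[OF that] f s])
  ultimately show "\<exists>g\<in>B_space \<Omega> M. \<forall>\<omega>\<in>\<Omega>. \<bar>fa_integral \<Omega> A (\<tau> \<omega>) f - g \<omega>\<bar> \<le> e"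
    by (intro bexI[of _ "\<lambda>\<omega>. simple_integral \<Omega> (\<tau> \<omega>) s"]) auto
qed

end

text \<open>At a single type the identity holds because the posterior is a function of the player's
  own field; linearity extends it to the hull. It survives weak* closure because \<open>f\<close>
  and its posterior are both admissible test functions.\<close>

lemma Pi_i_posterior:
  assumes "belief \<Omega> A M (t i)" and P: "P \<in> Pi_i \<Omega> A t i" and f: "f \<in> B_space \<Omega> A"
  shows "fa_integral \<Omega> A P (\<lambda>\<omega>. fa_integral \<Omega> A (t i \<omega>) f) = fa_integral \<Omega> A P f"
proof -
  interpret belief \<Omega> A M "t i" by fact
  let ?g = "\<lambda>\<omega>. fa_integral \<Omega> A (t i \<omega>) f"
  have gM: "?g \<in> B_space \<Omega> M"
    by (rule posterior_B_space[OF f])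
  then have gA: "?g \<in> B_space \<Omega> A"
    using B_space_mono[OF M_sub] by blast
  have eq: "fa_integral \<Omega> A \<nu> ?g = fa_integral \<Omega> A \<nu> f" if \<nu>: "\<nu> \<in> conv_types \<Omega> t i" for \<nu>
  proof -
    obtain n w l where wl: "\<forall>k<n. w k \<in> \<Omega> \<and> 0 \<le> l k" "(\<Sum>k<n. l k) = 1"
      "\<nu> = (\<lambda>E. \<Sum>k<(n::nat). l k * t i (w k) E)"
      using \<nu> unfolding conv_types_def by blast
    have int: "fa_integral \<Omega> A \<nu> k = (\<Sum>j<n. l j * fa_integral \<Omega> A (t i (w j)) k)" if "k \<in> B_space \<Omega> A" for k
      unfolding wl(3) using wl(1,2) that by (intro A.pba_convex_combination(2) pba) auto
    show ?thesis
      unfolding int[OF gA] int[OF f]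
      using wl(1) by (intro sum.cong refl) (simp add: integral_of_own_function[OF gM])
  qed
  have "\<bar>fa_integral \<Omega> A P ?g - fa_integral \<Omega> A P f\<bar> \<le> e" if "0 < e" for e
  proof -
    have "\<exists>\<nu>\<in>conv_types \<Omega> t i. \<forall>k\<in>{f, ?g}. \<bar>fa_integral \<Omega> A P k - fa_integral \<Omega> A \<nu> k\<bar> < e / 2"
    proof -
      have "finite {f, ?g} \<and> {f, ?g} \<subseteq> B_space \<Omega> A" "0 < e / 2"
        using f gA that by auto
      with P show ?thesis
        unfolding Pi_i_def weak_star_closure_def mem_Collect_eq by metis
    qed
    then obtain \<nu> where \<nu>: "\<nu> \<in> conv_types \<Omega> t i"
      "\<bar>fa_integral \<Omega> A P f - fa_integral \<Omega> A \<nu> f\<bar> < e / 2"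
      "\<bar>fa_integral \<Omega> A P ?g - fa_integral \<Omega> A \<nu> ?g\<bar> < e / 2"
      by auto
    with eq[OF \<nu>(1)] show ?thesis
      by linarith
  qed
  then have "\<bar>fa_integral \<Omega> A P ?g - fa_integral \<Omega> A P f\<bar> \<le> 0"
    by (rule field_le_epsilon) simp
  then show ?thesis
    by simp
qed

section \<open>Consistency and bets\<close>

lemma type_space_belief:
  "type_space \<Omega> A N M t \<Longrightarrow> i \<in> N \<Longrightarrow> belief \<Omega> A (M i) (t i)"
  by (auto simp: type_space_def belief_def belief_axioms_def)

section \<open>Consistency excludes weakly agreeable bets\<close>

lemma consistent_imp_not_weakly_agreeable:
  assumes T: "type_space \<Omega> A N M t" and cons: "universally_consistent \<Omega> A N t"
  shows "\<not> weakly_agreeable \<Omega> A N t I f"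
proof
  assume bet: "weakly_agreeable \<Omega> A N t I f"
  interpret algebra \<Omega> A
    using T by (simp add: type_space_def)
  define g where "g i \<omega> = fa_integral \<Omega> A (t i \<omega>) (f i)" for i \<omega>
  have I: "finite I" "I \<noteq> {}" "I \<subseteq> N" and fB: "\<And>i. i \<in> I \<Longrightarrow> f i \<in> B_space \<Omega> A"
    and zero: "\<And>\<omega>. \<omega> \<in> \<Omega> \<Longrightarrow> (\<Sum>i\<in>I. f i \<omega>) = 0"
    using bet by (auto simp: weakly_agreeable_def is_bet_def)
  \<comment> \<open>An event commonly certain at \<open>\<omega>\<close> contains
    \<open>\<omega>\<close>, so the first clause of weak agreeability gives nonnegativity at every
    state.\<close>
  have g_nonneg: "0 \<le> g i \<omega>" if "i \<in> I" "\<omega> \<in> \<Omega>" for i \<omega>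
    using bet that unfolding weakly_agreeable_def commonly_certain_def g_def by blast
  obtain S \<alpha> where S: "cc_component \<Omega> A t I S" and "0 < \<alpha>"
    and gS: "\<And>i \<omega>. i \<in> I \<Longrightarrow> \<omega> \<in> S \<Longrightarrow> \<alpha> \<le> g i \<omega>"
    using bet unfolding weakly_agreeable_def commonly_certain_def g_def by blast
  have "S \<subseteq> \<Omega>"
    using S by (simp add: cc_component_def)
  obtain P where P: "pba \<Omega> A P" "\<And>i. i \<in> I \<Longrightarrow> P \<in> Pi_i \<Omega> A t i"
    and outer: "0 < Inf {P E | E. E \<in> A \<and> S \<subseteq> E}"
    using cons[unfolded universally_consistent_def, rule_format, OF conjI[OF I(1) conjI[OF I(3) S]]]
    by blast
  note L = mean_fa_integral[OF P(1)]
  have belief: "belief \<Omega> A (M i) (t i)" if "i \<in> I" for i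
    using type_space_belief[OF T] I(3) that by blast
  have gB: "g i \<in> B_space \<Omega> A" if "i \<in> I" for i
  proof -
    interpret belief \<Omega> A "M i" "t i"
      by (rule belief[OF that])
    show ?thesis
      using posterior_B_space[OF fB[OF that]] B_space_mono[OF M_sub] unfolding g_def by blast
  qed
  have g_pos: "0 < fa_integral \<Omega> A P (g i)" if i: "i \<in> I" for i
  proof -
    \<comment> \<open>Outer measure is defined by sets of \<open>A\<close>, so \<open>S\<close> is
      enclosed in such a set on which \<open>g i\<close> is still at least
      \<open>\<alpha> / 2\<close>; a Markov-type bound follows.\<close>
    obtain E where E: "E \<in> A" "\<And>\<omega>. \<omega> \<in> \<Omega> \<Longrightarrow> \<alpha> \<le> g i \<omega> \<Longrightarrow> \<omega> \<in> E" "\<And>\<omega>. \<omega> \<in> E \<Longrightarrow> \<alpha> / 2 \<le> g i \<omega>"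
      using B_space_superlevel[OF gB[OF i], of "\<alpha> / 2" \<alpha>] \<open>0 < \<alpha>\<close> by auto
    have "S \<subseteq> E"
      using E(2) gS[OF i] \<open>S \<subseteq> \<Omega>\<close> by blast
    then have "Inf {P E | E. E \<in> A \<and> S \<subseteq> E} \<le> P E"
      using E(1) P(1) by (intro cInf_lower) (auto simp: pba_def bdd_below_def)
    then have "0 < \<alpha> / 2 * P E"
      using outer \<open>0 < \<alpha>\<close> by simp
    also have "\<dots> = fa_integral \<Omega> A P (\<lambda>\<omega>. \<alpha> / 2 * indicator E \<omega>)"
      unfolding mean_cmult[OF L B_space_indicator[OF E(1)]] fa_integral_indicator[OF P(1) E(1)] ..
    also have "\<dots> \<le> fa_integral \<Omega> A P (g i)"
      by (intro mean_mono[OF L B_space_cmult[OF B_space_indicator[OF E(1)]] gB[OF i]])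
        (use E(3) g_nonneg[OF i] in \<open>simp add: indicator_def\<close>)
    finally show ?thesis .
  qed
  have "0 < (\<Sum>i\<in>I. fa_integral \<Omega> A P (g i))"
    using I g_pos by (intro sum_pos)
  also have "\<dots> = (\<Sum>i\<in>I. fa_integral \<Omega> A P (f i))"
    unfolding g_def by (intro sum.cong refl Pi_i_posterior[OF belief P(2) fB])
  also have "\<dots> = fa_integral \<Omega> A P (\<lambda>\<omega>. \<Sum>i\<in>I. f i \<omega>)"
    by (rule mean_sum[OF L fB, symmetric])
  also have "\<dots> = fa_integral \<Omega> A P (\<lambda>_. 0)"
    by (rule mean_cong[OF L B_space_sum[OF fB] B_space_const]) (simp_all add: zero)
  also have "\<dots> = 0"
    by (rule mean_const[OF L])
  finally show False
    by simp
qed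

text \<open>Converts a witness that the cone of the next lemma contains \<open>-1\<close> into a
  bet. The gain is at least \<open>1 / n\<close> wherever all players are certain of
  \<open>E\<close>, in particular on \<open>S\<close>.\<close>

lemma weakly_agreeable_restriction:
  assumes T: "type_space \<Omega> A N M t" and I: "finite I" "I \<noteq> {}" "I \<subseteq> N"
    and S: "S \<noteq> {}" "S \<subseteq> \<Omega>" and E: "E \<in> A" "E \<subseteq> S" "\<And>\<omega> i. \<omega> \<in> S \<Longrightarrow> i \<in> I \<Longrightarrow> t i \<omega> E = 1"
    and h: "\<And>i. i \<in> I \<Longrightarrow> h i \<in> B_space \<Omega> A"
    and h_nonneg: "\<And>i \<omega>. i \<in> I \<Longrightarrow> \<omega> \<in> \<Omega> \<Longrightarrow> 0 \<le> fa_integral \<Omega> A (t i \<omega>) (h i)"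
    and h_sum: "\<And>\<omega>. \<omega> \<in> E \<Longrightarrow> (\<Sum>i\<in>I. h i \<omega>) \<le> - 1"
  shows "\<exists>f. weakly_agreeable \<Omega> A N t I f"
proof -
  interpret algebra \<Omega> A
    using T by (simp add: type_space_def)
  define n where "n = real (card I)"
  have n: "0 < n"
    using I by (simp add: n_def card_gt_0_iff)
  \<comment> \<open>Sharing the total equally makes the sum zero; on \<open>E\<close>, where the
    total is at most \<open>-1\<close>, each player receives at least
    \<open>h i + 1 / n\<close>.\<close>
  define k where "k i \<omega> = h i \<omega> - (1 / n) * (\<Sum>j\<in>I. h j \<omega>)" for i \<omega>
  define f where "f i \<omega> = k i \<omega> * indicator E \<omega>" for i \<omega>
  have kB: "k i \<in> B_space \<Omega> A" if "i \<in> I" for i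
    unfolding k_def using that by (intro B_space_diff B_space_cmult B_space_sum h)
  have fB: "f i \<in> B_space \<Omega> A" if "i \<in> I" for i
    unfolding f_def by (intro B_space_mult_indicator kB that E(1))
  have "(\<Sum>i\<in>I. k i \<omega>) = 0" for \<omega>
    using n unfolding k_def by (simp add: sum_subtractf n_def)
  then have "(\<Sum>i\<in>I. f i \<omega>) = 0" for \<omega>
    unfolding f_def by (simp flip: sum_distrib_right)
  then have bet: "is_bet \<Omega> A N I f"
    using I fB by (simp add: is_bet_def)
  have gain: "1 / n \<le> fa_integral \<Omega> A (t i \<omega>) (f i)" if i: "i \<in> I" and \<omega>: "\<omega> \<in> \<Omega>" and one: "t i \<omega> E = 1" for i \<omega>
  proof -
    interpret belief \<Omega> A "M i" "t i"
      using type_space_belief[OF T] I(3) i by blast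
    note L = mean_fa_integral[OF pba[OF \<omega>]]
    have hn: "(\<lambda>\<omega>. h i \<omega> + 1 / n) \<in> B_space \<Omega> A"
      by (intro B_space_add B_space_const h i)
    have "1 / n \<le> fa_integral \<Omega> A (t i \<omega>) (\<lambda>\<omega>. h i \<omega> + 1 / n)"
      using h_nonneg[OF i \<omega>] mean_add[OF L h[OF i] B_space_const] mean_const[OF L] by simp
    also have "\<dots> = fa_integral \<Omega> A (t i \<omega>) (\<lambda>\<omega>. (h i \<omega> + 1 / n) * indicator E \<omega>)"
      by (rule fa_integral_full_set[OF pba[OF \<omega>] E(1) one hn, symmetric])
    also have "\<dots> \<le> fa_integral \<Omega> A (t i \<omega>) (f i)"
    proof (rule mean_mono[OF L B_space_mult_indicator[OF hn E(1)] fB[OF i]])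
      fix \<omega>' assume "\<omega>' \<in> \<Omega>"
      show "(h i \<omega>' + 1 / n) * indicator E \<omega>' \<le> f i \<omega>'"
      proof (cases "\<omega>' \<in> E")
        case True
        have "(1 / n) * (\<Sum>j\<in>I. h j \<omega>') \<le> (1 / n) * - 1"
          using n h_sum[OF True] by (intro mult_left_mono) auto
        then show ?thesis
          using True by (simp add: f_def k_def)
      qed (simp add: f_def)
    qed
    finally show ?thesis .
  qed
  have nonneg: "0 \<le> fa_integral \<Omega> A (t i \<omega>) (f i)" if i: "i \<in> I" and \<omega>: "\<omega> \<in> \<Omega>" for i \<omega>
  proof -
    interpret belief \<Omega> A "M i" "t i"
      using type_space_belief[OF T] I(3) i by blast
    \<comment> \<open>As \<open>E\<close> lies in \<open>S\<close>, it is certain at each of its own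
      points. Probability 0 makes the truncated stake worth 0, and probability 1 gives the gain
      above.\<close>
    have "t i \<omega> E = 0 \<or> t i \<omega> E = 1"
      using E i by (intro self_certain_zero_one \<omega>) auto
    then show ?thesis
    proof
      assume "t i \<omega> E = 0"
      then show ?thesis
        using fa_integral_null_set[OF pba[OF \<omega>] E(1) _ kB[OF i]] unfolding f_def by simp
    next
      assume "t i \<omega> E = 1"
      from gain[OF i \<omega> this] show ?thesis
        using n by (meson divide_nonneg_pos order_trans zero_le_one)
    qed
  qed
  have "t i \<omega> \<Omega> = 1" if "i \<in> I" "\<omega> \<in> \<Omega>" for i \<omega>
    using T I(3) that by (auto simp: type_space_def pba_def)
  \<comment> \<open>\<open>\<Omega>\<close> itself serves as component for the nonnegativity clause,
    \<open>S\<close> for the strict one.\<close>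
  then have "cc_component \<Omega> A t I \<Omega>"
    using S top by (auto simp: cc_component_def)
  then have "commonly_certain \<Omega> A t I {\<omega>'\<in>\<Omega>. \<forall>i\<in>I. fa_integral \<Omega> A (t i \<omega>') (f i) \<ge> 0} \<omega>"
    if "\<omega> \<in> \<Omega>" for \<omega>
    unfolding commonly_certain_def using nonneg that by (intro exI[of _ \<Omega>]) auto
  moreover have "cc_component \<Omega> A t I S"
    using S E by (auto simp: cc_component_def)
  then have "commonly_certain \<Omega> A t I {\<omega>'\<in>\<Omega>. \<forall>i\<in>I. fa_integral \<Omega> A (t i \<omega>') (f i) \<ge> 1 / n} \<omega>"
    if "\<omega> \<in> S" for \<omega>
    unfolding commonly_certain_def using gain S(2) E(3) that by (intro exI[of _ S]) auto
  moreover obtain \<omega>\<^sub>0 where "\<omega>\<^sub>0 \<in> S"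
    using S(1) by blast
  moreover have "0 < 1 / n"
    using n by simp
  ultimately have "weakly_agreeable \<Omega> A N t I f"
    unfolding weakly_agreeable_def using bet S(2) by blast
  then show ?thesis
    by blast
qed

lemma no_bet_imp_prior:
  assumes T: "type_space \<Omega> A N M t" and I: "finite I" "I \<noteq> {}" "I \<subseteq> N"
    and comp: "cc_component \<Omega> A t I S" and no_bet: "\<And>f. \<not> weakly_agreeable \<Omega> A N t I f"
  obtains L where "mean \<Omega> A L" "\<And>i. i \<in> I \<Longrightarrow> (\<lambda>E. L (indicator E)) \<in> Pi_i \<Omega> A t i"
    "\<And>F. F \<in> A \<Longrightarrow> S \<subseteq> F \<Longrightarrow> 1 \<le> L (indicator F)"
proof -
  interpret algebra \<Omega> A
    using T by (simp add: type_space_def)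
  obtain E where S: "S \<noteq> {}" "S \<subseteq> \<Omega>" and E: "E \<in> A" "E \<subseteq> S" "\<And>\<omega> i. \<omega> \<in> S \<Longrightarrow> i \<in> I \<Longrightarrow> t i \<omega> E = 1"
    using comp unfolding cc_component_def by blast
  have pba: "pba \<Omega> A (t i \<omega>)" if "i \<in> I" "\<omega> \<in> \<Omega>" for i \<omega>
    using T I(3) that by (auto simp: type_space_def)
  define K where "K i = {h \<in> B_space \<Omega> A. \<forall>\<omega>\<in>\<Omega>. 0 \<le> fa_integral \<Omega> A (t i \<omega>) h}" for i
  have KB: "h \<in> B_space \<Omega> A" if "h \<in> K i" for h i
    using that by (simp add: K_def)
  have K_nonneg: "0 \<le> fa_integral \<Omega> A (t i \<omega>) h" if "h \<in> K i" "\<omega> \<in> \<Omega>" for h i \<omega>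
    using that by (simp add: K_def)
  have K0: "(\<lambda>_. 0) \<in> K i" if "i \<in> I" for i
    using mean_const[OF mean_fa_integral[OF pba[OF that]]] by (simp add: K_def B_space_const)
  have K_add: "(\<lambda>\<omega>. g \<omega> + h \<omega>) \<in> K i" if "i \<in> I" "g \<in> K i" "h \<in> K i" for g h i
    using that mean_add[OF mean_fa_integral[OF pba[OF that(1)]] KB[OF that(2)] KB[OF that(3)]]
    by (simp add: K_def B_space_add)
  have K_cmult: "(\<lambda>\<omega>. c * h \<omega>) \<in> K i" if "i \<in> I" "h \<in> K i" "0 \<le> c" for c h i
    using that mean_cmult[OF mean_fa_integral[OF pba[OF that(1)]] KB[OF that(2)]]
    by (simp add: K_def B_space_cmult)
  \<comment> \<open>Domination is required only on \<open>E\<close>, so every function in B that is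
    nonnegative on \<open>E\<close> belongs to \<open>C\<close>. This is what makes the resulting
    mean carried by \<open>E\<close>.\<close>
  define C where "C = {f \<in> B_space \<Omega> A. \<exists>h. (\<forall>i\<in>I. h i \<in> K i) \<and> (\<forall>\<omega>\<in>E. (\<Sum>i\<in>I. h i \<omega>) \<le> f \<omega>)}"
  have C_I: "f \<in> C" if "f \<in> B_space \<Omega> A" "\<And>i. i \<in> I \<Longrightarrow> h i \<in> K i"
    "\<And>\<omega>. \<omega> \<in> E \<Longrightarrow> (\<Sum>i\<in>I. h i \<omega>) \<le> f \<omega>" for f h
    unfolding C_def using that by blast
  have C_E: "\<exists>h. (\<forall>i\<in>I. h i \<in> K i) \<and> (\<forall>\<omega>\<in>E. (\<Sum>i\<in>I. h i \<omega>) \<le> f \<omega>)" if "f \<in> C" for f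
    using that by (simp add: C_def)
  have CB: "f \<in> B_space \<Omega> A" if "f \<in> C" for f
    using that by (simp add: C_def)
  have C_nonneg: "f \<in> C" if "f \<in> B_space \<Omega> A" "\<And>\<omega>. \<omega> \<in> E \<Longrightarrow> 0 \<le> f \<omega>" for f
    by (rule C_I[of f "\<lambda>_ _. 0"]) (use that K0 in auto)
  have cone: "pos_cone \<Omega> A C"
    unfolding pos_cone_def
  proof (intro conjI ballI allI impI)
    show "C \<subseteq> B_space \<Omega> A"
      using CB by blast
  next
    fix f g assume fg: "f \<in> C" "g \<in> C"
    obtain h where h: "\<And>i. i \<in> I \<Longrightarrow> h i \<in> K i" "\<And>\<omega>. \<omega> \<in> E \<Longrightarrow> (\<Sum>i\<in>I. h i \<omega>) \<le> f \<omega>"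
      using C_E[OF fg(1)] by blast
    obtain h' where h': "\<And>i. i \<in> I \<Longrightarrow> h' i \<in> K i" "\<And>\<omega>. \<omega> \<in> E \<Longrightarrow> (\<Sum>i\<in>I. h' i \<omega>) \<le> g \<omega>"
      using C_E[OF fg(2)] by blast
    show "(\<lambda>\<omega>. f \<omega> + g \<omega>) \<in> C"
    proof (rule C_I[of _ "\<lambda>i \<omega>. h i \<omega> + h' i \<omega>"])
      show "(\<Sum>i\<in>I. h i \<omega> + h' i \<omega>) \<le> f \<omega> + g \<omega>" if "\<omega> \<in> E" for \<omega>
        using h(2)[OF that] h'(2)[OF that] by (simp add: sum.distrib)
    qed (use B_space_add CB fg K_add h h' in auto)
  next
    fix f and c :: real assume f: "f \<in> C" and c: "0 \<le> c"
    obtain h where h: "\<And>i. i \<in> I \<Longrightarrow> h i \<in> K i" "\<And>\<omega>. \<omega> \<in> E \<Longrightarrow> (\<Sum>i\<in>I. h i \<omega>) \<le> f \<omega>"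
      using C_E[OF f] by blast
    show "(\<lambda>\<omega>. c * f \<omega>) \<in> C"
    proof (rule C_I[of _ "\<lambda>i \<omega>. c * h i \<omega>"])
      show "(\<Sum>i\<in>I. c * h i \<omega>) \<le> c * f \<omega>" if "\<omega> \<in> E" for \<omega>
        unfolding sum_distrib_left[symmetric] using h(2)[OF that] c by (rule mult_left_mono)
    qed (use B_space_cmult CB f K_cmult h c in auto)
  next
    fix f assume "f \<in> B_space \<Omega> A" "\<forall>\<omega>\<in>\<Omega>. 0 \<le> f \<omega>"
    then show "f \<in> C"
      using E(2) S(2) by (intro C_nonneg) auto
  qed
  have "(\<lambda>_. - 1) \<notin> C"
  proof
    assume "(\<lambda>_. - 1) \<in> C"
    then obtain h where h: "\<And>i. i \<in> I \<Longrightarrow> h i \<in> K i" "\<And>\<omega>. \<omega> \<in> E \<Longrightarrow> (\<Sum>i\<in>I. h i \<omega>) \<le> - 1"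
      using C_E by blast
    have "\<exists>f. weakly_agreeable \<Omega> A N t I f"
      by (rule weakly_agreeable_restriction[OF T I S E, of h])
        (use h(2) KB[OF h(1)] K_nonneg[OF h(1)] in auto)
    with no_bet show False
      by blast
  qed
  then obtain L where L: "mean \<Omega> A L" and L_nonneg: "\<And>f. f \<in> C \<Longrightarrow> 0 \<le> L f"
    using mean_of_pos_cone[OF cone] by blast
  have "(\<lambda>E. L (indicator E)) \<in> Pi_i \<Omega> A t i" if i: "i \<in> I" for i
  proof (rule mean_in_Pi_i[of t i, OF pba[OF i] _ L])
    show "\<Omega> \<noteq> {}"
      using S by blast
    fix h assume h: "h \<in> B_space \<Omega> A" "\<And>\<omega>. \<omega> \<in> \<Omega> \<Longrightarrow> 0 \<le> fa_integral \<Omega> A (t i \<omega>) h"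
    have "h \<in> C"
    proof (rule C_I[OF h(1), of "\<lambda>j. if j = i then h else (\<lambda>_. 0)"])
      show "(if j = i then h else (\<lambda>_. 0)) \<in> K j" if "j \<in> I" for j
        using K0[OF that] h by (simp add: K_def)
      have "(\<Sum>j\<in>I. (if j = i then h else (\<lambda>_. 0)) \<omega>) = (\<Sum>j\<in>I. if j = i then h \<omega> else 0)" for \<omega>
        by (intro sum.cong) auto
      then show "(\<Sum>j\<in>I. (if j = i then h else (\<lambda>_. 0)) \<omega>) \<le> h \<omega>" for \<omega>
        using I(1) i by simp
    qed
    then show "0 \<le> L h"
      by (rule L_nonneg)
  qed
  moreover have "1 \<le> L (indicator F)" if F: "F \<in> A" "S \<subseteq> F" for F
  proof -
    \<comment> \<open>The function vanishes on \<open>E\<close>, since \<open>E\<close> lies in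
      \<open>S\<close> and \<open>S\<close> in \<open>F\<close>.\<close>
    have "(\<lambda>\<omega>. indicator F \<omega> - 1) \<in> C"
      by (rule C_nonneg) (use F E(2) in \<open>auto intro!: B_space_diff B_space_indicator B_space_const\<close>)
    then show ?thesis
      using L_nonneg[of "\<lambda>\<omega>. indicator F \<omega> - 1"] mean_diff[OF L B_space_indicator[OF F(1)] B_space_const]
        mean_const[OF L] by simp
  qed
  ultimately show ?thesis
    using that L by blast
qed

lemma not_weakly_agreeable_imp_consistent:
  assumes T: "type_space \<Omega> A N M t" and no_bet: "\<And>I f. \<not> weakly_agreeable \<Omega> A N t I f"
  shows "universally_consistent \<Omega> A N t"
  unfolding universally_consistent_def
proof (intro allI impI, elim conjE)
  fix I S assume I: "finite I" "I \<subseteq> N" and comp: "cc_component \<Omega> A t I S"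
  interpret algebra \<Omega> A
    using T by (simp add: type_space_def)
  have S: "S \<noteq> {}" "S \<subseteq> \<Omega>"
    using comp by (auto simp: cc_component_def)
  have "\<exists>L. mean \<Omega> A L \<and> (\<forall>i\<in>I. (\<lambda>E. L (indicator E)) \<in> Pi_i \<Omega> A t i) \<and>
      (\<forall>F\<in>A. S \<subseteq> F \<longrightarrow> 1 \<le> L (indicator F))"
  proof (cases "I = {}")
    \<comment> \<open>A bet has a nonempty set of players, so the absence of bets says nothing here.
      The conditions on priors are vacuous, and evaluation at a point of \<open>S\<close>
      suffices.\<close>
    case True
    obtain \<omega> where "\<omega> \<in> S"
      using S by blast
    then show ?thesis
      using S True by (intro exI[of _ "\<lambda>f. f \<omega>"]) (auto simp: mean_eval)
  next
    case False
    show ?thesis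
      by (rule no_bet_imp_prior[OF T I(1) False I(2) comp no_bet]) blast
  qed
  then obtain L where L: "mean \<Omega> A L" "\<forall>i\<in>I. (\<lambda>E. L (indicator E)) \<in> Pi_i \<Omega> A t i"
    and one: "\<And>F. F \<in> A \<Longrightarrow> S \<subseteq> F \<Longrightarrow> 1 \<le> L (indicator F)"
    by blast
  \<comment> \<open>The infimum is over a nonempty set, because \<open>\<Omega>\<close> is an
    admissible \<open>E\<close>.\<close>
  have "1 \<le> Inf {L (indicator E) | E. E \<in> A \<and> S \<subseteq> E}"
    by (rule cInf_greatest) (use S one in auto)
  then have "0 < Inf {L (indicator E) | E. E \<in> A \<and> S \<subseteq> E}"
    by linarith
  then show "\<exists>P. pba \<Omega> A P \<and> (\<forall>i\<in>I. P \<in> Pi_i \<Omega> A t i) \<and> 0 < Inf {P E | E. E \<in> A \<and> S \<subseteq> E}"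
    using mean_imp_pba[OF L(1)] L(2) by blast
qed

theorem theorem4:
  fixes \<Omega> :: "'w set" and A :: "'w set set" and N :: "'i set"
    and M :: "'i \<Rightarrow> 'w set set" and t :: "'i \<Rightarrow> 'w \<Rightarrow> 'w set \<Rightarrow> real"
  assumes "type_space \<Omega> A N M t"
  shows "universally_consistent \<Omega> A N t \<longleftrightarrow>
         \<not> (\<exists>I f. weakly_agreeable \<Omega> A N t I f)"
  using consistent_imp_not_weakly_agreeable[OF assms] not_weakly_agreeable_imp_consistent[OF assms]
  by blast

end
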